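(* Let $\{\Phi_a\}_{a\in I}$ be a variable-radius family of free boundary minimal hypersurfaces $\Sigma_a$ in concentric geodesic balls $B(r(a))$ of a space form $\mathbb{M}^{n+1}_\kappa$, with parametric field $\varphi_a$. Then, for every $a\in I$, on $\partial\Sigma$, $$\partial_\eta\varphi_a-\operatorname{ct}_\kappa(r(a))\,\varphi_a=r'(a)\,A_a(\eta,\eta),$$ where $\eta$ is the outward unit conormal and $A_a$ the second fundamental form of $\Sigma_a$.
   Context: For $\kappa\in\{-1,0,1\}$, $\mathbb{M}^{n+1}_\kappa$ is the complete simply connected space form of constant sectional curvature $\kappa$, with Levi-Civita connection $\overline\nabla$. Fix $p_0$, let $\rho=\operatorname{dist}(p_0,\cdot)$, $B(r)$ the closed geodesic ball of radius $r>0$ centred at $p_0$ ($r<\pi$ if $\kappa=1$), $S(r)=\partial B(r)$, and $\operatorname{ct}_\kappa(t)=\coth t,\ 1/t,\ \cot t$ for $\kappa=-1,0,1$. A free boundary minimal immersion in $B(r)$ is a two-sided minimal immersion $\Phi:\Sigma^n\to B(r)$ of a compact manifold with nonempty boundary, with $\Phi(\partial\Sigma)\subset S(r)$, meeting $S(r)$ orthogonally along $\partial\Sigma$; equivalently the outward unit conormal $\eta$ of $\partial\Sigma$ in $\Sigma$ equals $\partial_\rho$ along $\partial\Sigma$. With $\nu$ a smooth unit normal, $A(X,Y)=\langle\overline\nabla_X\nu,Y\rangle$. A variable-radius family is a smooth map $\Phi:I\times\Sigma\to\mathbb{M}^{n+1}_\kappa$, $I\subset\mathbb{R}$ an interval,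 $\Sigma$ a compact $n$-manifold with boundary each of whose connected components has nonempty boundary, such that every $\Phi_a=\Phi(a,\cdot)$ is a free boundary minimal immersion in $B(r(a))$ (all balls centred at $p_0$), with $r:I\to(0,\infty)$ smooth and $r<\pi$ if $\kappa=1$. The unit normals $\nu_a$ are chosen smoothly in $a$, and the parametric field is $\varphi_a=\langle\partial_a\Phi_a,\nu_a\rangle\in C^\infty(\Sigma)$. $\Sigma_a$ denotes $\Sigma$ with the immersion $\Phi_a$. *)

theory Defs
  imports "HOL-Analysis.Analysis"
begin

section \<open>Smooth maps between Euclidean spaces\<close>

fun Ck_on :: "nat \<Rightarrow> 'a::real_normed_vector set \<Rightarrow> ('a \<Rightarrow> 'b::real_normed_vector) \<Rightarrow> bool" where
  "Ck_on 0 W f \<longleftrightarrow> continuous_on W f"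
| "Ck_on (Suc k) W f \<longleftrightarrow>
     f differentiable_on W \<and> (\<forall>v. Ck_on k W (\<lambda>x. frechet_derivative f (at x) v))"

text \<open>On a set that need not be open (a relatively open part of a half-space, an interval with
  end points, a product of such sets), smoothness means that smooth extensions exist locally.\<close>

definition smooth_map_on :: "'a::real_normed_vector set \<Rightarrow> ('a \<Rightarrow> 'b::real_normed_vector) \<Rightarrow> bool" where
  "smooth_map_on S f \<longleftrightarrow>
     (\<forall>x\<in>S. \<exists>W g. open W \<and> x \<in> W \<and> (\<forall>k. Ck_on k W g) \<and> (\<forall>y\<in>S \<inter> W. g y = f y))"


section \<open>Smooth manifolds with boundary\<close>

text \<open>The model is the half-space of points with nonnegative coordinate in one fixed basis
  direction of \<open>'e\<close>; which basis direction is chosen is immaterial.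
  A chart is a pair of its domain and its coordinate map.\<close>

definition inward_dir :: "'e::euclidean_space" where
  "inward_dir = (SOME b. b \<in> Basis)"

definition half_space :: "'e::euclidean_space set" where
  "half_space = {x. 0 \<le> x \<bullet> inward_dir}"

type_synonym ('s, 'e) chart = "'s set \<times> ('s \<Rightarrow> 'e)"

definition chart_dom :: "('s, 'e) chart \<Rightarrow> 's set" where
  "chart_dom c = fst c"

definition chart_map :: "('s, 'e) chart \<Rightarrow> 's \<Rightarrow> 'e" where
  "chart_map c = snd c"

definition chart_img :: "('s, 'e) chart \<Rightarrow> 'e set" where
  "chart_img c = chart_map c ` chart_dom c"

definition in_chart :: "('s, 'e) chart \<Rightarrow> ('s \<Rightarrow> 'b) \<Rightarrow> 'e \<Rightarrow> 'b" where
  "in_chart c f = (\<lambda>x. f (inv_into (chart_dom c) (chart_map c) x))"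

definition manifold_with_boundary ::
    "'s topology \<Rightarrow> ('s, 'e::euclidean_space) chart set \<Rightarrow> bool" where
  "manifold_with_boundary M \<A> \<longleftrightarrow>
     Hausdorff_space M \<and> second_countable M \<and>
     (\<Union>c\<in>\<A>. chart_dom c) = topspace M \<and>
     (\<forall>c\<in>\<A>. openin M (chart_dom c) \<and>
        openin (top_of_set half_space) (chart_img c) \<and>
        homeomorphic_map (subtopology M (chart_dom c)) (top_of_set (chart_img c)) (chart_map c)) \<and>
     (\<forall>c\<in>\<A>. \<forall>d\<in>\<A>.
        smooth_map_on (chart_map c ` (chart_dom c \<inter> chart_dom d)) (in_chart c (chart_map d)))"

definition manifold_boundary :: "('s, 'e::euclidean_space) chart set \<Rightarrow> 's set" where
  "manifold_boundary \<A> = {p. \<exists>c\<in>\<A>. p \<in> chart_dom c \<and> chart_map c p \<bullet> inward_dir = 0}"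

definition smooth_on_manifold ::
    "('s, 'e::euclidean_space) chart set \<Rightarrow> ('s \<Rightarrow> 'b::real_normed_vector) \<Rightarrow> bool" where
  "smooth_on_manifold \<A> f \<longleftrightarrow> (\<forall>c\<in>\<A>. smooth_map_on (chart_img c) (in_chart c f))"

definition smooth_family_on_manifold ::
    "real set \<Rightarrow> ('s, 'e::euclidean_space) chart set \<Rightarrow>
     (real \<Rightarrow> 's \<Rightarrow> 'b::real_normed_vector) \<Rightarrow> bool" where
  "smooth_family_on_manifold I \<A> f \<longleftrightarrow>
     (\<forall>c\<in>\<A>. smooth_map_on (I \<times> chart_img c) (\<lambda>(a, x). in_chart c (f a) x))"

text \<open>A tangent vector at \<open>p\<close> is represented by its coordinate vector \<open>w\<close> in a chart \<open>c\<close> around \<open>p\<close>;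
  \<open>mderiv c f p w\<close> is the derivative of \<open>f\<close> at \<open>p\<close> in the direction of that tangent vector.
  The derivative within the chart image is unique also at boundary points.\<close>

definition mderiv ::
    "('s, 'e::euclidean_space) chart \<Rightarrow> ('s \<Rightarrow> 'b::real_normed_vector) \<Rightarrow> 's \<Rightarrow> 'e \<Rightarrow> 'b" where
  "mderiv c f p = frechet_derivative (in_chart c f) (at (chart_map c p) within chart_img c)"


section \<open>The space forms\<close>

text \<open>For \<open>\<kappa> \<in> {-1, 0, 1}\<close> and \<open>DIM('v) = n + 1\<close>, the space form is realised in \<open>'v \<times> real\<close> as the
  upper sheet of the hyperboloid in Minkowski space, the affine hyperplane at height \<open>1\<close>, and the
  unit sphere, respectively. Its Riemannian metric is the restriction of the bilinear form
  \<open>ambient_form \<kappa>\<close> to tangent vectors.\<close>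

definition ambient_form :: "real \<Rightarrow> 'v::euclidean_space \<times> real \<Rightarrow> 'v \<times> real \<Rightarrow> real" where
  "ambient_form \<kappa> u v = fst u \<bullet> fst v + \<kappa> * (snd u * snd v)"

definition space_form :: "real \<Rightarrow> ('v::euclidean_space \<times> real) set" where
  "space_form \<kappa> = {q. (snd q)\<^sup>2 + \<kappa> * (fst q \<bullet> fst q) = 1 \<and> (\<kappa> \<le> 0 \<longrightarrow> 0 < snd q)}"

definition tangent_space :: "real \<Rightarrow> 'v::euclidean_space \<times> real \<Rightarrow> ('v \<times> real) set" where
  "tangent_space \<kappa> q = {v. snd q * snd v + \<kappa> * (fst q \<bullet> fst v) = 0}"

definition space_dist :: "real \<Rightarrow> 'v::euclidean_space \<times> real \<Rightarrow> 'v \<times> real \<Rightarrow> real" where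
  "space_dist \<kappa> p q =
     (if \<kappa> = 1 then arccos (ambient_form \<kappa> p q)
      else if \<kappa> = -1 then arcosh (- ambient_form \<kappa> p q)
      else dist p q)"

definition geodesic_ball :: "real \<Rightarrow> 'v::euclidean_space \<times> real \<Rightarrow> real \<Rightarrow> ('v \<times> real) set" where
  "geodesic_ball \<kappa> p0 R = {q \<in> space_form \<kappa>. space_dist \<kappa> p0 q \<le> R}"

definition geodesic_sphere :: "real \<Rightarrow> 'v::euclidean_space \<times> real \<Rightarrow> real \<Rightarrow> ('v \<times> real) set" where
  "geodesic_sphere \<kappa> p0 R = {q \<in> space_form \<kappa>. space_dist \<kappa> p0 q = R}"

text \<open>Riemannian gradient at \<open>q\<close> of a function that is differentiable at \<open>q\<close>.\<close>

definition space_gradient ::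
    "real \<Rightarrow> ('v::euclidean_space \<times> real \<Rightarrow> real) \<Rightarrow> 'v \<times> real \<Rightarrow> 'v \<times> real" where
  "space_gradient \<kappa> f q =
     (THE X. X \<in> tangent_space \<kappa> q \<and>
        (\<forall>\<gamma> v. range \<gamma> \<subseteq> space_form \<kappa> \<and> \<gamma> 0 = q \<and> (\<gamma> has_vector_derivative v) (at (0::real)) \<longrightarrow>
           ((\<lambda>t. f (\<gamma> t)) has_real_derivative ambient_form \<kappa> X v) (at 0)))"

definition radial_field :: "real \<Rightarrow> 'v::euclidean_space \<times> real \<Rightarrow> 'v \<times> real \<Rightarrow> 'v \<times> real" where
  "radial_field \<kappa> p0 = space_gradient \<kappa> (space_dist \<kappa> p0)"

definition ct :: "real \<Rightarrow> real \<Rightarrow> real" where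
  "ct \<kappa> t = (if \<kappa> = 1 then cot t else if \<kappa> = -1 then cosh t / sinh t else 1 / t)"

text \<open>The Levi-Civita connection is the tangential part of the flat connection of \<open>'v \<times> real\<close>.
  For \<open>\<kappa> = 1\<close> and \<open>\<kappa> = -1\<close> the position vector \<open>q\<close> is normal to the space form with
  \<open>ambient_form \<kappa> q q = \<kappa>\<close>; for \<open>\<kappa> = 0\<close> derivatives of tangent fields are already tangential.\<close>

definition tangential_part :: "real \<Rightarrow> 'v::euclidean_space \<times> real \<Rightarrow> 'v \<times> real \<Rightarrow> 'v \<times> real" where
  "tangential_part \<kappa> q u = u - (\<kappa> * ambient_form \<kappa> u q) *\<^sub>R q"

definition covariant_deriv ::
    "real \<Rightarrow> ('s, 'e::euclidean_space) chart \<Rightarrow> ('s \<Rightarrow> 'v::euclidean_space \<times> real) \<Rightarrow>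
     ('s \<Rightarrow> 'v \<times> real) \<Rightarrow> 's \<Rightarrow> 'e \<Rightarrow> 'v \<times> real" where
  "covariant_deriv \<kappa> c F Y p w = tangential_part \<kappa> (F p) (mderiv c Y p w)"


section \<open>Immersed hypersurfaces\<close>

definition induced_metric ::
    "real \<Rightarrow> ('s, 'e::euclidean_space) chart \<Rightarrow> ('s \<Rightarrow> 'v::euclidean_space \<times> real) \<Rightarrow>
     's \<Rightarrow> 'e \<Rightarrow> 'e \<Rightarrow> real" where
  "induced_metric \<kappa> c F p w u = ambient_form \<kappa> (mderiv c F p w) (mderiv c F p u)"

definition immersion_into_space_form ::
    "real \<Rightarrow> ('s, 'e::euclidean_space) chart set \<Rightarrow> ('s \<Rightarrow> 'v::euclidean_space \<times> real) \<Rightarrow> bool" where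
  "immersion_into_space_form \<kappa> \<A> F \<longleftrightarrow>
     smooth_on_manifold \<A> F \<and>
     (\<forall>c\<in>\<A>. \<forall>p\<in>chart_dom c. F p \<in> space_form \<kappa> \<and> inj (mderiv c F p))"

definition smooth_unit_normal ::
    "real \<Rightarrow> ('s, 'e::euclidean_space) chart set \<Rightarrow> ('s \<Rightarrow> 'v::euclidean_space \<times> real) \<Rightarrow>
     ('s \<Rightarrow> 'v \<times> real) \<Rightarrow> bool" where
  "smooth_unit_normal \<kappa> \<A> F N \<longleftrightarrow>
     smooth_on_manifold \<A> N \<and>
     (\<forall>c\<in>\<A>. \<forall>p\<in>chart_dom c.
        N p \<in> tangent_space \<kappa> (F p) \<and> ambient_form \<kappa> (N p) (N p) = 1 \<and>
        (\<forall>w. ambient_form \<kappa> (N p) (mderiv c F p w) = 0))"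

definition second_fundamental_form ::
    "real \<Rightarrow> ('s, 'e::euclidean_space) chart \<Rightarrow> ('s \<Rightarrow> 'v::euclidean_space \<times> real) \<Rightarrow>
     ('s \<Rightarrow> 'v \<times> real) \<Rightarrow> 's \<Rightarrow> 'e \<Rightarrow> 'e \<Rightarrow> real" where
  "second_fundamental_form \<kappa> c F N p w u =
     ambient_form \<kappa> (covariant_deriv \<kappa> c F N p w) (mderiv c F p u)"

definition orthonormal_frame ::
    "real \<Rightarrow> ('s, 'e::euclidean_space) chart \<Rightarrow> ('s \<Rightarrow> 'v::euclidean_space \<times> real) \<Rightarrow>
     's \<Rightarrow> ('e \<Rightarrow> 'e) \<Rightarrow> bool" where
  "orthonormal_frame \<kappa> c F p e \<longleftrightarrow>
     (\<forall>i\<in>Basis. \<forall>j\<in>Basis. induced_metric \<kappa> c F p (e i) (e j) = (if i = j then 1 else 0))"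

definition minimal_immersion ::
    "real \<Rightarrow> ('s, 'e::euclidean_space) chart set \<Rightarrow> ('s \<Rightarrow> 'v::euclidean_space \<times> real) \<Rightarrow>
     ('s \<Rightarrow> 'v \<times> real) \<Rightarrow> bool" where
  "minimal_immersion \<kappa> \<A> F N \<longleftrightarrow>
     immersion_into_space_form \<kappa> \<A> F \<and> smooth_unit_normal \<kappa> \<A> F N \<and>
     (\<forall>c\<in>\<A>. \<forall>p\<in>chart_dom c. \<forall>e. orthonormal_frame \<kappa> c F p e \<longrightarrow>
        (\<Sum>i\<in>Basis. second_fundamental_form \<kappa> c F N p (e i) (e i)) = 0)"

text \<open>\<open>w\<close> is the coordinate vector, in a chart \<open>c\<close> around the boundary point \<open>p\<close>, of the outward unit
  conormal: the boundary has coordinate tangent space \<open>{u. u \<bullet> inward_dir = 0}\<close>. The first conjunct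
  holds for every chart around a boundary point.\<close>

definition outward_unit_conormal ::
    "real \<Rightarrow> ('s, 'e::euclidean_space) chart \<Rightarrow> ('s \<Rightarrow> 'v::euclidean_space \<times> real) \<Rightarrow>
     's \<Rightarrow> 'e \<Rightarrow> bool" where
  "outward_unit_conormal \<kappa> c F p w \<longleftrightarrow>
     chart_map c p \<bullet> inward_dir = 0 \<and>
     w \<bullet> inward_dir < 0 \<and>
     induced_metric \<kappa> c F p w w = 1 \<and>
     (\<forall>u. u \<bullet> inward_dir = 0 \<longrightarrow> induced_metric \<kappa> c F p w u = 0)"

text \<open>The hypersurface and the sphere meet orthogonally: their unit normals \<open>N p\<close> and
  \<open>radial_field \<kappa> p0 (F p)\<close> are orthogonal.\<close>

definition free_boundary_minimal ::
    "real \<Rightarrow> 'v::euclidean_space \<times> real \<Rightarrow> real \<Rightarrow> 's topology \<Rightarrow>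
     ('s, 'e::euclidean_space) chart set \<Rightarrow> ('s \<Rightarrow> 'v \<times> real) \<Rightarrow> ('s \<Rightarrow> 'v \<times> real) \<Rightarrow> bool" where
  "free_boundary_minimal \<kappa> p0 R M \<A> F N \<longleftrightarrow>
     manifold_with_boundary M \<A> \<and> compact_space M \<and> manifold_boundary \<A> \<noteq> {} \<and>
     minimal_immersion \<kappa> \<A> F N \<and>
     F ` topspace M \<subseteq> geodesic_ball \<kappa> p0 R \<and>
     F ` manifold_boundary \<A> \<subseteq> geodesic_sphere \<kappa> p0 R \<and>
     (\<forall>p\<in>manifold_boundary \<A>. ambient_form \<kappa> (N p) (radial_field \<kappa> p0 (F p)) = 0)"

text \<open>The interval is nondegenerate, so that derivatives with respect to the parameter make sense;
  they are one-sided at end points that belong to it.\<close>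

definition variable_radius_family ::
    "real \<Rightarrow> 'v::euclidean_space \<times> real \<Rightarrow> real set \<Rightarrow> (real \<Rightarrow> real) \<Rightarrow> 's topology \<Rightarrow>
     ('s, 'e::euclidean_space) chart set \<Rightarrow>
     (real \<Rightarrow> 's \<Rightarrow> 'v \<times> real) \<Rightarrow> (real \<Rightarrow> 's \<Rightarrow> 'v \<times> real) \<Rightarrow> bool" where
  "variable_radius_family \<kappa> p0 I r M \<A> \<Phi> \<nu> \<longleftrightarrow>
     is_interval I \<and> interior I \<noteq> {} \<and>
     smooth_map_on I r \<and> (\<forall>a\<in>I. 0 < r a \<and> (\<kappa> = 1 \<longrightarrow> r a < pi)) \<and>
     (\<forall>C\<in>connected_components_of M. C \<inter> manifold_boundary \<A> \<noteq> {}) \<and>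
     smooth_family_on_manifold I \<A> \<Phi> \<and>
     smooth_family_on_manifold I \<A> \<nu> \<and>
     (\<forall>a\<in>I. free_boundary_minimal \<kappa> p0 (r a) M \<A> (\<Phi> a) (\<nu> a))"

definition parametric_field ::
    "real \<Rightarrow> real set \<Rightarrow> (real \<Rightarrow> 's \<Rightarrow> 'v::euclidean_space \<times> real) \<Rightarrow>
     (real \<Rightarrow> 's \<Rightarrow> 'v \<times> real) \<Rightarrow> real \<Rightarrow> 's \<Rightarrow> real" where
  "parametric_field \<kappa> I \<Phi> \<nu> a p =
     ambient_form \<kappa> (vector_derivative (\<lambda>s. \<Phi> s p) (at a within I)) (\<nu> a p)"

end

theory Submission
  imports Defs
begin

text \<open>The space form sits in the flat space \<open>'v \<times> real\<close> with the form \<open>\<langle>\<cdot>,\<cdot>\<rangle>\<close> = \<^const>\<open>ambient_form\<close>, and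
everything is computed with ordinary derivatives there. This works because the radial field is
affine along each sphere: on the sphere of radius \<open>R\<close> around \<open>p0\<close> one has
\<open>sn(R) \<partial>\<^sub>\<rho> = X\<close> with \<open>X = cs(R) q - p0\<close>, where \<open>q\<close> is the position vector (\<open>radial_field_eq\<close>).

Let \<open>V = \<partial>\<^sub>a\<Phi>\<close>, so that \<open>\<phi> = \<langle>V, \<nu>\<rangle>\<close>, and work at a boundary point. Then \<open>d\<Phi>(\<eta>) = \<partial>\<^sub>\<rho>\<close>: the field
\<open>\<partial>\<^sub>\<rho>\<close> is tangent to the hypersurface, because it is orthogonal to \<open>\<nu>\<close>, it is orthogonal to the
boundary, because the boundary lies in a sphere, and it points outward, because the hypersurface
stays in the ball (\<open>conormal_is_radial\<close>).

The product rule gives \<open>\<partial>\<^sub>\<eta>\<phi> = \<langle>\<partial>\<^sub>\<eta>V, \<nu>\<rangle> + \<langle>V, \<partial>\<^sub>\<eta>\<nu>\<rangle>\<close>.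

\<^item> First term. Since \<open>\<partial>\<^sub>\<eta>V = \<partial>\<^sub>a(d\<Phi>(\<eta>))\<close> and \<open>\<langle>d\<Phi>(\<eta>), \<nu>\<rangle> = 0\<close> for all parameters, it equals
\<open>- \<langle>\<partial>\<^sub>\<rho>, \<partial>\<^sub>a\<nu>\<rangle>\<close>. Differentiating the free boundary condition \<open>\<langle>\<nu>, cs(r) \<Phi> - p0\<rangle> = 0\<close> in \<open>a\<close> turns
this into \<open>ct(r) \<phi>\<close>; the derivative of \<open>cs(r)\<close> does not contribute, as it multiplies
\<open>\<kappa>\<langle>\<nu>, \<Phi>\<rangle> = 0\<close> (\<open>free_boundary_velocity\<close>).

\<^item> Second term. Decompose \<open>V = \<phi> \<nu> + c d\<Phi>(\<eta>) + d\<Phi>(u)\<close> with \<open>u\<close> tangent to the boundary. As the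
boundary point stays on the sphere of radius \<open>r(a)\<close>, \<open>c = \<langle>V, \<partial>\<^sub>\<rho>\<rangle> = r'\<close> (\<open>radial_velocity\<close>). Moreover
\<open>\<langle>\<nu>, \<partial>\<^sub>\<eta>\<nu>\<rangle> = 0\<close>, and \<open>\<langle>d\<Phi>(u), \<partial>\<^sub>\<eta>\<nu>\<rangle> = \<langle>d\<Phi>(\<eta>), \<partial>\<^sub>u\<nu>\<rangle>\<close> by symmetry of the second fundamental form; the
latter vanishes by differentiating the free boundary condition along the boundary
(\<open>free_boundary_tangent\<close>). So the second term is \<open>r' A(\<eta>, \<eta>)\<close>.

Both commutations of derivatives rest on Schwarz's theorem (\<open>mixed_derivatives_commute\<close>). The maps
are defined only on products of an interval with a relatively open part of a half-space, so they are
replaced by local smooth extensions; identities that hold on such a set may still be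
differentiated there in every direction (\<open>axis_accessible_derivative_constant\<close>).\<close>

section \<open>Symmetry of second derivatives\<close>

abbreviation dir_deriv where "dir_deriv f z v \<equiv> frechet_derivative f (at z) v"

text \<open>The second difference of \<open>f\<close> over a parallelogram is the increment of \<open>s \<mapsto> f (\<dots> + h w) - f (\<dots>)\<close> along
\<open>v\<close>; the mean value theorem applied along \<open>v\<close> and then along \<open>w\<close> expresses it by a mixed derivative at
an interior point.\<close>

lemma second_difference:
  fixes f :: "'a::real_normed_vector \<Rightarrow> real"
  assumes f: "\<And>x. x \<in> W \<Longrightarrow> (f has_derivative f' x) (at x)"
    and A: "\<And>x. x \<in> W \<Longrightarrow> ((\<lambda>y. f' y v) has_derivative A x) (at x)"
    and h: "0 < h"
    and W: "\<And>s t. 0 \<le> s \<Longrightarrow> s \<le> h \<Longrightarrow> 0 \<le> t \<Longrightarrow> t \<le> h \<Longrightarrow> z + s *\<^sub>R v + t *\<^sub>R w \<in> W"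
  obtains s t where "0 < s" "s < h" "0 < t" "t < h"
    "f (z + h *\<^sub>R v + h *\<^sub>R w) - f (z + h *\<^sub>R v) - f (z + h *\<^sub>R w) + f z = h * h * A (z + s *\<^sub>R v + t *\<^sub>R w) w"
proof -
  define g where "g s = f (z + s *\<^sub>R v + h *\<^sub>R w) - f (z + s *\<^sub>R v)" for s
  have line1: "((\<lambda>s. f (z + s *\<^sub>R v + t *\<^sub>R w)) has_real_derivative f' (z + s *\<^sub>R v + t *\<^sub>R w) v) (at s)"
    if "0 \<le> s" "s \<le> h" "0 \<le> t" "t \<le> h" for s t
  proof -
    have "((\<lambda>s. z + s *\<^sub>R v + t *\<^sub>R w) has_derivative (\<lambda>k. k *\<^sub>R v)) (at s)"
      by (auto intro!: derivative_eq_intros)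
    from has_derivative_compose[OF this f[OF W[OF that]]]
    show ?thesis
      by (simp add: has_real_derivative_iff_has_vector_derivative has_vector_derivative_def linear_cmul[OF has_derivative_linear[OF f[OF W[OF that]]]])
  qed
  have g': "(g has_real_derivative f' (z + s *\<^sub>R v + h *\<^sub>R w) v - f' (z + s *\<^sub>R v) v) (at s)"
    if "0 \<le> s" "s \<le> h" for s
    unfolding g_def using line1[OF that, of h] line1[OF that, of 0] h
    by (auto intro!: DERIV_diff)
  obtain s where s: "0 < s" "s < h" and
    gs: "g h - g 0 = (h - 0) * (f' (z + s *\<^sub>R v + h *\<^sub>R w) v - f' (z + s *\<^sub>R v) v)"
    using MVT2[OF h g'] by auto
  have line2: "((\<lambda>t. f' (z + s *\<^sub>R v + t *\<^sub>R w) v) has_real_derivative A (z + s *\<^sub>R v + t *\<^sub>R w) w) (at t)"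
    if "0 \<le> t" "t \<le> h" for t
  proof -
    have W': "z + s *\<^sub>R v + t *\<^sub>R w \<in> W" using W that s by simp
    have "((\<lambda>t. z + s *\<^sub>R v + t *\<^sub>R w) has_derivative (\<lambda>k. k *\<^sub>R w)) (at t)"
      by (auto intro!: derivative_eq_intros)
    from has_derivative_compose[OF this A[OF W']]
    show ?thesis
      by (simp add: has_real_derivative_iff_has_vector_derivative has_vector_derivative_def linear_cmul[OF has_derivative_linear[OF A[OF W']]])
  qed
  obtain t where t: "0 < t" "t < h" and
    "f' (z + s *\<^sub>R v + h *\<^sub>R w) v - f' (z + s *\<^sub>R v + 0 *\<^sub>R w) v = (h - 0) * A (z + s *\<^sub>R v + t *\<^sub>R w) w"
    using MVT2[OF h line2] by auto
  with gs have "g h - g 0 = h * h * A (z + s *\<^sub>R v + t *\<^sub>R w) w" by simp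
  then show thesis using that[OF s t] by (simp add: g_def)
qed

text \<open>The second difference is symmetric in \<open>v\<close> and \<open>w\<close>, so on arbitrarily small parallelograms the two mixed
derivatives agree at points close to \<open>z\<close>; continuity moves this to \<open>z\<close>.\<close>

lemma mixed_derivatives_commute_real:
  fixes f :: "'a::real_normed_vector \<Rightarrow> real"
  assumes W: "open W" "z \<in> W"
    and f: "\<And>x. x \<in> W \<Longrightarrow> (f has_derivative f' x) (at x)"
    and A: "\<And>x. x \<in> W \<Longrightarrow> ((\<lambda>y. f' y v) has_derivative A x) (at x)"
    and B: "\<And>x. x \<in> W \<Longrightarrow> ((\<lambda>y. f' y w) has_derivative B x) (at x)"
    and contA: "continuous_on W (\<lambda>x. A x w)" and contB: "continuous_on W (\<lambda>x. B x v)"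
  shows "A z w = B z v"
proof -
  have "\<bar>A z w - B z v\<bar> \<le> e" if "e > 0" for e
  proof -
    have "continuous_on W (\<lambda>x. A x w)" by fact
    from this[unfolded continuous_on_iff, rule_format, OF W(2), of "e/2"] that
    obtain d1 where d1: "d1 > 0" "\<And>x. x \<in> W \<Longrightarrow> dist x z < d1 \<Longrightarrow> \<bar>A x w - A z w\<bar> < e/2"
      by (auto simp: dist_real_def)
    from contB[unfolded continuous_on_iff, rule_format, OF W(2), of "e/2"] that
    obtain d2 where d2: "d2 > 0" "\<And>x. x \<in> W \<Longrightarrow> dist x z < d2 \<Longrightarrow> \<bar>B x v - B z v\<bar> < e/2"
      by (auto simp: dist_real_def)
    obtain d3 where d3: "d3 > 0" "ball z d3 \<subseteq> W"
      using W open_contains_ball by blast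
    define d where "d = min d1 (min d2 d3)"
    have d: "d > 0" using d1 d2 d3 by (simp add: d_def)
    define h where "h = d / (norm v + norm w + 1)"
    have pos: "norm v + norm w + 1 > 0" by (simp add: add_nonneg_pos)
    have h: "h > 0" using d pos by (simp add: h_def)
    have near: "dist (z + s *\<^sub>R v + t *\<^sub>R w) z < d" if "0 \<le> s" "s \<le> h" "0 \<le> t" "t \<le> h" for s t
    proof -
      have "dist (z + s *\<^sub>R v + t *\<^sub>R w) z = norm (s *\<^sub>R v + t *\<^sub>R w)" by (simp add: dist_norm algebra_simps)
      also have "\<dots> \<le> s * norm v + t * norm w" using that norm_triangle_ineq[of "s *\<^sub>R v" "t *\<^sub>R w"] by simp
      also have "\<dots> \<le> h * norm v + h * norm w" using that by (intro add_mono mult_right_mono) auto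
      also have "\<dots> < h * (norm v + norm w + 1)" using h by (simp add: algebra_simps)
      also have "\<dots> = d" using pos by (simp add: h_def)
      finally show ?thesis .
    qed
    have inW: "z + s *\<^sub>R v + t *\<^sub>R w \<in> W" if "0 \<le> s" "s \<le> h" "0 \<le> t" "t \<le> h" for s t
      using near[OF that] d3(2) by (auto simp: d_def dist_commute)
    have inW': "z + s *\<^sub>R w + t *\<^sub>R v \<in> W" if "0 \<le> s" "s \<le> h" "0 \<le> t" "t \<le> h" for s t
      using inW[of t s] that by (simp add: algebra_simps)
    obtain s t where st: "0 < s" "s < h" "0 < t" "t < h" and eqA:
      "f (z + h *\<^sub>R v + h *\<^sub>R w) - f (z + h *\<^sub>R v) - f (z + h *\<^sub>R w) + f z = h * h * A (z + s *\<^sub>R v + t *\<^sub>R w) w"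
      by (rule second_difference[OF f A h inW])
    obtain s' t' where st': "0 < s'" "s' < h" "0 < t'" "t' < h" and eqB:
      "f (z + h *\<^sub>R w + h *\<^sub>R v) - f (z + h *\<^sub>R w) - f (z + h *\<^sub>R v) + f z = h * h * B (z + s' *\<^sub>R w + t' *\<^sub>R v) v"
      by (rule second_difference[OF f B h inW'])
    have "h * h * A (z + s *\<^sub>R v + t *\<^sub>R w) w = h * h * B (z + s' *\<^sub>R w + t' *\<^sub>R v) v"
      using eqA eqB unfolding add.assoc add.commute[of "h *\<^sub>R w"] by linarith
    then have eq: "A (z + s *\<^sub>R v + t *\<^sub>R w) w = B (z + t' *\<^sub>R v + s' *\<^sub>R w) v"
      using h by (simp add: add.assoc add.commute[of "s' *\<^sub>R w"])
    have "\<bar>A (z + s *\<^sub>R v + t *\<^sub>R w) w - A z w\<bar> < e/2"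
      using d1(2)[OF inW] near[of s t] st by (simp add: d_def)
    moreover have "\<bar>B (z + t' *\<^sub>R v + s' *\<^sub>R w) v - B z v\<bar> < e/2"
      using d2(2)[OF inW] near[of t' s'] st' by (simp add: d_def)
    ultimately show ?thesis using eq by linarith
  qed
  then have "\<bar>A z w - B z v\<bar> \<le> 0" by (rule field_le_epsilon) simp
  then show ?thesis by simp
qed

lemma Ck_on_has_derivative:
  assumes "Ck_on (Suc k) W f" "open W" "x \<in> W"
  shows "(f has_derivative frechet_derivative f (at x)) (at x)"
  using assms differentiable_on_eq_differentiable_at[of W f] frechet_derivative_works[of f "at x"]
  by (metis Ck_on.simps(2))

text \<open>Schwarz's theorem, reduced to real functions by pairing with a vector \<open>b\<close>.\<close>

lemma mixed_derivatives_commute: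
  fixes f :: "'a::real_normed_vector \<Rightarrow> 'b::real_inner"
  assumes C2: "Ck_on (Suc (Suc 0)) W f" and W: "open W" "z \<in> W"
  shows "dir_deriv (\<lambda>x. dir_deriv f x v) z w = dir_deriv (\<lambda>x. dir_deriv f x w) z v"
proof -
  have C1: "Ck_on (Suc 0) W (\<lambda>x. dir_deriv f x u)" for u
    using C2 Ck_on.simps(2)[of "Suc 0" W f] by blast
  have C0: "continuous_on W (\<lambda>x. dir_deriv (\<lambda>x. dir_deriv f x u) x u')" for u u'
    using C1[of u] Ck_on.simps(1)[of W] Ck_on.simps(2)[of 0 W] by blast
  have D1: "((\<lambda>x. f x \<bullet> b) has_derivative (\<lambda>u. dir_deriv f x u \<bullet> b)) (at x)" if "x \<in> W" for x b
    by (intro has_derivative_inner_left Ck_on_has_derivative[OF C2 W(1) that])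
  have D2: "((\<lambda>x. dir_deriv f x u \<bullet> b) has_derivative (\<lambda>u'. dir_deriv (\<lambda>x. dir_deriv f x u) x u' \<bullet> b)) (at x)"
    if "x \<in> W" for x u b
    by (intro has_derivative_inner_left Ck_on_has_derivative[OF C1 W(1) that])
  have "dir_deriv (\<lambda>x. dir_deriv f x v) z w \<bullet> b = dir_deriv (\<lambda>x. dir_deriv f x w) z v \<bullet> b" for b
    using mixed_derivatives_commute_real[where f = "\<lambda>x. f x \<bullet> b", OF W D1 D2 D2]
      continuous_on_inner[OF C0 continuous_on_const] by blast
  then show ?thesis
    by (metis inner_commute vector_eq_rdot)
qed

lemma Ck_on_subset: "Ck_on k W f \<Longrightarrow> V \<subseteq> W \<Longrightarrow> Ck_on k V f"
proof (induction k arbitrary: f)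
  case 0 then show ?case using continuous_on_subset by auto
next
  case (Suc k)
  have "f differentiable_on V"
    using Suc.prems differentiable_on_subset[of f W V] Ck_on.simps(2) by blast
  moreover have "Ck_on k V (\<lambda>x. frechet_derivative f (at x) v)" for v
    using Suc Ck_on.simps(2) by blast
  ultimately show ?case using Ck_on.simps(2) by blast
qed

section \<open>Derivatives within half-spaces and intervals\<close>

text \<open>A substitute for interior points: derivatives within \<open>S\<close> are unique at such a point, and the boundary
points of half-spaces and intervals qualify, since \<open>d\<close> may have a fixed sign for each axis.\<close>

definition axis_accessible :: "'a::euclidean_space \<Rightarrow> 'a set \<Rightarrow> bool" where
  "axis_accessible x S \<longleftrightarrow> (\<forall>i\<in>Basis. \<forall>e>0. \<exists>d. 0 < \<bar>d\<bar> \<and> \<bar>d\<bar> < e \<and> x + d *\<^sub>R i \<in> S)"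

lemma axis_accessible_UNIV: "axis_accessible x UNIV"
proof -
  have "\<exists>d. 0 < \<bar>d\<bar> \<and> \<bar>d\<bar> < e" if "0 < e" for e :: real
    by (rule exI[of _ "e/2"]) (use that in simp)
  then show ?thesis by (simp add: axis_accessible_def)
qed

lemma axis_accessible_derivative_unique:
  assumes "axis_accessible x S" "(f has_derivative f') (at x within S)" "(f has_derivative f'') (at x within S)"
  shows "f' = f''"
  by (rule frechet_derivative_unique_within[OF assms(2,3)]) (use assms(1) in \<open>auto simp: axis_accessible_def\<close>)

text \<open>An identity on \<open>S\<close> may be differentiated at a point of \<open>S\<close> in all directions, also in those that leave
\<open>S\<close>, since the axis directions along which \<open>S\<close> is accessible span the space.\<close>

lemma axis_accessible_derivative_constant:
  assumes acc: "axis_accessible x S" and x: "x \<in> S" and f: "(f has_derivative f') (at x within S)"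
    and c: "\<And>y. y \<in> S \<Longrightarrow> f y = c"
  shows "f' v = 0"
proof -
  have "((\<lambda>_. c) has_derivative f') (at x within S)"
    by (rule has_derivative_transform_within[OF f zero_less_one x]) (simp add: c)
  then have "f' = (\<lambda>_. 0)"
    by (rule axis_accessible_derivative_unique[OF acc]) (rule has_derivative_const)
  then show ?thesis by simp
qed

lemma axis_accessible_Times:
  assumes "axis_accessible a I" "axis_accessible x U" "a \<in> I" "x \<in> U"
  shows "axis_accessible (a, x) (I \<times> U)"
  unfolding axis_accessible_def
proof (intro ballI allI impI)
  fix i :: "'a \<times> 'b" and e :: real assume i: "i \<in> Basis" and e: "0 < e"
  from i consider j where "j \<in> Basis" "i = (j, 0)" | j where "j \<in> Basis" "i = (0, j)"
    by (auto simp: Basis_prod_def)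
  then show "\<exists>d. 0 < \<bar>d\<bar> \<and> \<bar>d\<bar> < e \<and> (a, x) + d *\<^sub>R i \<in> I \<times> U"
  proof cases
    case 1
    then obtain d where "0 < \<bar>d\<bar>" "\<bar>d\<bar> < e" "a + d *\<^sub>R j \<in> I"
      using assms(1) e unfolding axis_accessible_def by blast
    with 1 assms(4) show ?thesis by (intro exI[of _ d]) simp
  next
    case 2
    then obtain d where "0 < \<bar>d\<bar>" "\<bar>d\<bar> < e" "x + d *\<^sub>R j \<in> U"
      using assms(2) e unfolding axis_accessible_def by blast
    with 2 assms(3) show ?thesis by (intro exI[of _ d]) simp
  qed
qed

lemma axis_accessible_Int_open:
  assumes acc: "axis_accessible x S" and W: "open W" "x \<in> W"
  shows "axis_accessible x (S \<inter> W)"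
  unfolding axis_accessible_def
proof (intro ballI allI impI)
  fix i :: 'a and e :: real assume i: "i \<in> Basis" and e: "0 < e"
  obtain k where k: "0 < k" "ball x k \<subseteq> W" using W open_contains_ball by blast
  obtain d where d: "0 < \<bar>d\<bar>" "\<bar>d\<bar> < min e k" "x + d *\<^sub>R i \<in> S"
    using acc i e k(1) unfolding axis_accessible_def by (metis min_less_iff_conj)
  have "dist x (x + d *\<^sub>R i) < k" using d i by (simp add: dist_norm)
  then have "x + d *\<^sub>R i \<in> W" using k by auto
  with d show "\<exists>d. 0 < \<bar>d\<bar> \<and> \<bar>d\<bar> < e \<and> x + d *\<^sub>R i \<in> S \<inter> W" by auto
qed

text \<open>Short segments that stay in the half-space stay in \<open>U\<close>. At a boundary point this covers both signs of
\<open>t\<close> for directions along the boundary, and one sign for transversal directions.\<close>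

lemma half_space_open_line:
  fixes U :: "'e::euclidean_space set"
  assumes U: "openin (top_of_set half_space) U" "x \<in> U"
  obtains e where "0 < e"
    "\<And>t. \<bar>t\<bar> < e \<Longrightarrow> 0 \<le> x \<bullet> inward_dir + t * (w \<bullet> inward_dir) \<Longrightarrow> x + t *\<^sub>R w \<in> U"
proof -
  obtain k where k: "0 < k" "ball x k \<inter> half_space \<subseteq> U"
    using U by (metis openin_contains_ball)
  have e: "0 < k / (norm w + 1)" using k by (simp add: add_nonneg_pos)
  moreover have "x + t *\<^sub>R w \<in> U" if t: "\<bar>t\<bar> < k / (norm w + 1)" "0 \<le> x \<bullet> inward_dir + t * (w \<bullet> inward_dir)" for t
  proof -
    have "\<bar>t\<bar> * (norm w + 1) < k" using t(1) by (simp add: pos_less_divide_eq add_nonneg_pos)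
    then have "dist x (x + t *\<^sub>R w) < k"
      using abs_ge_zero[of t] by (simp add: dist_norm distrib_left)
    then show ?thesis using k t(2) by (auto simp: half_space_def inner_add_left)
  qed
  ultimately show thesis by (rule that)
qed

lemma inward_dir_Basis: "inward_dir \<in> Basis"
  unfolding inward_dir_def by (rule someI_ex) (use nonempty_Basis in blast)

lemma axis_accessible_half_space_open:
  fixes U :: "'e::euclidean_space set"
  assumes U: "openin (top_of_set half_space) U" "x \<in> U"
  shows "axis_accessible x U"
  unfolding axis_accessible_def
proof (intro ballI allI impI)
  fix i :: 'e and e :: real assume i: "i \<in> Basis" and e: "0 < e"
  obtain k where k: "0 < k" "\<And>t. \<bar>t\<bar> < k \<Longrightarrow> 0 \<le> x \<bullet> inward_dir + t * (i \<bullet> inward_dir) \<Longrightarrow> x + t *\<^sub>R i \<in> U"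
    using half_space_open_line[OF U, of i] by blast
  have "0 \<le> x \<bullet> inward_dir" using U openin_imp_subset[OF U(1)] by (auto simp: half_space_def)
  moreover have "0 \<le> i \<bullet> inward_dir" by (simp add: inner_Basis[OF i inward_dir_Basis])
  ultimately show "\<exists>d. 0 < \<bar>d\<bar> \<and> \<bar>d\<bar> < e \<and> x + d *\<^sub>R i \<in> U"
    using k e by (intro exI[of _ "min e k / 2"]) auto
qed

lemma interval_approachable:
  fixes I :: "real set"
  assumes "is_interval I" "interior I \<noteq> {}" "a \<in> I"
  shows "at a within I \<noteq> bot" "axis_accessible a I"
proof -
  have "I \<noteq> {x}" for x using assms(2) by auto
  then have lim: "a islimpt I"
    using connected_imp_perfect[of I a] assms(1,3) is_interval_connected by blast
  then show "at a within I \<noteq> bot" by (simp add: trivial_limit_within)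
  show "axis_accessible a I"
    unfolding axis_accessible_def
  proof (intro ballI allI impI)
    fix i e :: real assume i: "i \<in> Basis" and e: "0 < e"
    obtain b where b: "b \<in> I" "b \<noteq> a" "\<bar>b - a\<bar> < e"
      using lim e by (auto simp: islimpt_approachable_real)
    with i show "\<exists>d. 0 < \<bar>d\<bar> \<and> \<bar>d\<bar> < e \<and> a + d *\<^sub>R i \<in> I"
      by (intro exI[of _ "b - a"]) auto
  qed
qed

lemma has_derivative_along_line:
  assumes "(f has_derivative D) (at z)"
  shows "((\<lambda>t. f (z + t *\<^sub>R v)) has_vector_derivative D v) (at (0::real))"
proof -
  have line: "((\<lambda>t. z + t *\<^sub>R v) has_derivative (\<lambda>t. t *\<^sub>R v)) (at (0::real))"
    by (auto intro!: derivative_eq_intros)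
  have "(f has_derivative D) (at (z + 0 *\<^sub>R v))" using assms by simp
  from has_derivative_compose[OF line this] show ?thesis
    by (simp add: has_vector_derivative_def linear_cmul[OF has_derivative_linear[OF assms]])
qed

lemma has_derivative_time_slice:
  fixes f :: "real \<times> 'e::real_normed_vector \<Rightarrow> 'b::real_normed_vector"
  assumes "(f has_derivative D) (at (a, x))"
  shows "((\<lambda>s. f (s, x)) has_vector_derivative D (1, 0)) (at a within I)"
proof -
  have "((\<lambda>s. (s, x)) has_derivative (\<lambda>t. (t, 0))) (at a within I)"
    by (auto intro!: derivative_eq_intros)
  from has_derivative_compose[OF this assms]
  have "((\<lambda>s. f (s, x)) has_derivative (\<lambda>t. D (t, 0))) (at a within I)" .
  also have "(\<lambda>t. D (t, 0)) = (\<lambda>t. t *\<^sub>R D (1, 0))"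
  proof
    fix t show "D (t, 0) = t *\<^sub>R D (1, 0)"
      using linear_cmul[OF has_derivative_linear[OF assms], of t "(1, 0)"] by simp
  qed
  finally show ?thesis unfolding has_vector_derivative_def .
qed

lemma has_derivative_space_slice:
  fixes f :: "real \<times> 'e::real_normed_vector \<Rightarrow> 'b::real_normed_vector"
  assumes "(f has_derivative D) (at (a, x))"
  shows "((\<lambda>y. f (a, y)) has_derivative (\<lambda>w. D (0, w))) (at x within U)"
proof -
  have "((\<lambda>y. (a, y)) has_derivative (\<lambda>w. (0, w))) (at x within U)"
    by (auto intro!: derivative_eq_intros)
  from has_derivative_compose[OF this assms] show ?thesis .
qed

lemma open_slices:
  fixes W :: "(real \<times> 'e::real_normed_vector) set"
  assumes "open W" "(a, x) \<in> W"
  shows "\<exists>e>0. (\<forall>s. dist s a < e \<longrightarrow> (s, x) \<in> W) \<and> (\<forall>y. dist y x < e \<longrightarrow> (a, y) \<in> W)"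
proof -
  obtain k where k: "0 < k" "ball (a, x) k \<subseteq> W" using assms open_contains_ball by blast
  have "(s, x) \<in> W" if "dist s a < k" for s
    by (rule subsetD[OF k(2)]) (use that in \<open>simp add: dist_prod_def dist_commute\<close>)
  moreover have "(a, y) \<in> W" if "dist y x < k" for y
    by (rule subsetD[OF k(2)]) (use that in \<open>simp add: dist_prod_def dist_commute\<close>)
  ultimately show ?thesis using k(1) by blast
qed

text \<open>Computes derivatives in a chart from local extensions of the coordinate representation; by
accessibility the derivative within the chart image is unique also at boundary points.\<close>

lemma mderiv_eqI:
  assumes p: "p \<in> chart_dom c" and U: "openin (top_of_set half_space) (chart_img c)"
    and f: "(f' has_derivative D) (at (chart_map c p) within chart_img c)"
    and e: "0 < e" "\<And>y. y \<in> chart_img c \<Longrightarrow> dist y (chart_map c p) < e \<Longrightarrow> in_chart c f y = f' y"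
  shows "mderiv c f p = D"
proof -
  have x: "chart_map c p \<in> chart_img c" using p by (simp add: chart_img_def)
  have "(in_chart c f has_derivative D) (at (chart_map c p) within chart_img c)"
    by (rule has_derivative_transform_within[OF f e(1) x]) (simp add: e(2))
  moreover from this have "(in_chart c f has_derivative mderiv c f p) (at (chart_map c p) within chart_img c)"
    unfolding mderiv_def using frechet_derivative_works differentiable_def by blast
  ultimately show ?thesis
    using axis_accessible_derivative_unique[OF axis_accessible_half_space_open[OF U x]] by blast
qed

section \<open>Tangent spaces of the space forms\<close>

interpretation ambient: bounded_bilinear "ambient_form \<kappa> :: 'v::euclidean_space \<times> real \<Rightarrow> _" for \<kappa>
  by (auto simp: bilinear_conv_bounded_bilinear[symmetric] bilinear_def ambient_form_def inner_simps algebra_simps intro!: linearI)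

lemma ambient_form_commute: "ambient_form \<kappa> u v = ambient_form \<kappa> v u"
  by (simp add: ambient_form_def inner_commute mult.commute)

lemma space_form_height_zero: "q \<in> space_form 0 \<Longrightarrow> snd q = 1"
  by (auto simp: space_form_def power2_eq_1_iff)

lemma tangent_space_height_zero: "q \<in> space_form 0 \<Longrightarrow> v \<in> tangent_space 0 q \<Longrightarrow> snd v = 0"
  using space_form_height_zero[of q] by (auto simp: tangent_space_def)

lemma tangent_space_hyperplane: "tangent_space \<kappa> q = {v. (\<kappa> *\<^sub>R fst q, snd q) \<bullet> v = 0}"
  by (auto simp: tangent_space_def inner_prod_def add.commute)

lemma subspace_tangent_space: "subspace (tangent_space \<kappa> q)"
  unfolding tangent_space_hyperplane by (rule subspace_hyperplane)

lemma position_form: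
  assumes "\<kappa> \<in> {-1, 0, 1}" "q \<in> space_form \<kappa>"
  shows "\<kappa> * ambient_form \<kappa> q q = \<kappa> * \<kappa>"
  using assms by (auto simp: space_form_def ambient_form_def power2_eq_square)

lemma position_orthogonal:
  assumes "\<kappa> \<in> {-1, 0, 1}" "v \<in> tangent_space \<kappa> q"
  shows "\<kappa> * ambient_form \<kappa> q v = 0"
  using assms by (auto simp: tangent_space_def ambient_form_def)

text \<open>For \<open>\<kappa> = -1\<close> the form is indefinite on the ambient space, but a null vector orthogonal to the timelike
position vector vanishes by the Cauchy--Schwarz inequality; for \<open>\<kappa> = 0\<close> tangent vectors have no component
in the degenerate direction.\<close>

lemma tangent_form_definite:
  assumes \<kappa>: "\<kappa> \<in> {-1, 0, 1}" and q: "q \<in> space_form \<kappa>" and v: "v \<in> tangent_space \<kappa> q"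
    and 0: "ambient_form \<kappa> v v = 0"
  shows "v = 0"
proof -
  consider "\<kappa> = 1" | "\<kappa> = 0" | "\<kappa> = -1" using \<kappa> by auto
  then have "fst v = 0 \<and> snd v = 0"
  proof cases
    case 1
    have "fst v \<bullet> fst v + snd v * snd v = 0" using 0 1 by (simp add: ambient_form_def)
    then show ?thesis
      by (metis add_nonneg_eq_0_iff inner_eq_zero_iff inner_ge_zero mult_eq_0_iff zero_le_square)
  next
    case 2
    then show ?thesis using 0 tangent_space_height_zero[of q v] q v by (auto simp: ambient_form_def)
  next
    case 3
    have q2: "snd q * snd q = 1 + fst q \<bullet> fst q" and qv: "snd q * snd v = fst q \<bullet> fst v"
      and vv: "fst v \<bullet> fst v = snd v * snd v"
      using 0 q v 3 by (auto simp: space_form_def tangent_space_def ambient_form_def power2_eq_square)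
    have "(fst q \<bullet> fst v)\<^sup>2 \<le> (fst q \<bullet> fst q) * (fst v \<bullet> fst v)" by (rule Cauchy_Schwarz_ineq)
    then have "(snd q * snd q) * (snd v * snd v) \<le> (fst q \<bullet> fst q) * (snd v * snd v)"
      by (simp add: qv[symmetric] vv power2_eq_square mult.assoc mult.left_commute)
    then have "snd v * snd v \<le> 0" by (simp add: q2 distrib_right)
    then have "snd v = 0" by (metis mult_eq_0_iff order_antisym zero_le_square)
    then show ?thesis using vv by simp
  qed
  then show ?thesis by (simp add: prod_eq_iff)
qed

lemma dim_tangent_space:
  assumes \<kappa>: "\<kappa> \<in> {-1, 0, 1}" and q: "q \<in> space_form \<kappa>"
  shows "dim (tangent_space \<kappa> (q :: 'v::euclidean_space \<times> real)) = DIM('v)"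
proof -
  have "(\<kappa> *\<^sub>R fst q, snd q) \<noteq> 0"
    using q by (auto simp: space_form_def zero_prod_def)
  then show ?thesis unfolding tangent_space_hyperplane by (simp add: dim_hyperplane)
qed

text \<open>By dimension count, the image of the differential of an immersed hypersurface and its unit normal
together span the tangent space of the space form.\<close>

lemma tangent_decomposition:
  fixes q :: "'v::euclidean_space \<times> real" and P :: "'e::euclidean_space \<Rightarrow> 'v \<times> real"
  assumes \<kappa>: "\<kappa> \<in> {-1, 0, 1}" and q: "q \<in> space_form \<kappa>" and dim: "DIM('v) = DIM('e) + 1"
    and P: "linear P" "inj P" "range P \<subseteq> tangent_space \<kappa> q"
    and N: "N \<in> tangent_space \<kappa> q" "ambient_form \<kappa> N N = 1" "\<And>w. ambient_form \<kappa> N (P w) = 0"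
    and Y: "Y \<in> tangent_space \<kappa> q"
  obtains w where "Y = ambient_form \<kappa> Y N *\<^sub>R N + P w"
proof -
  have sub: "subspace (range P)"
    by (rule linear_subspace_image[OF P(1) subspace_UNIV])
  have span: "span (range P) = range P" using sub by (simp only: span_eq_iff)
  have "N \<notin> span (range P)" unfolding span
  proof
    assume "N \<in> range P"
    then obtain w where "N = P w" by blast
    then show False using N(2) N(3)[of w] by simp
  qed
  moreover have "dim (range P) = DIM('e)"
    using dim_image_eq[OF P(1), of UNIV] P(2) by simp
  ultimately have "dim (span (insert N (range P))) = DIM('v)"
    using dim by (simp only: dim_span dim_insert if_False)
  moreover have "span (insert N (range P)) \<subseteq> tangent_space \<kappa> q"
    by (rule span_minimal[OF _ subspace_tangent_space]) (use N(1) P(3) in blast)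
  ultimately have "span (insert N (range P)) = tangent_space \<kappa> q"
    by (intro subspace_dim_equal) (simp_all add: subspace_tangent_space dim_tangent_space[OF \<kappa> q])
  then obtain k where "Y - k *\<^sub>R N \<in> span (range P)"
    using Y span_breakdown_eq[of Y N "range P"] by blast
  then have "Y - k *\<^sub>R N \<in> range P"
    by (simp only: span)
  then obtain w where "Y - k *\<^sub>R N = P w" by blast
  then have w: "Y = k *\<^sub>R N + P w" by (simp add: algebra_simps)
  have k: "ambient_form \<kappa> Y N = k"
    unfolding w ambient.add_left ambient.scaleR_left ambient_form_commute[of _ "P w" N]
    using N(2) N(3)[of w] by simp
  show thesis by (rule that[of w], unfold k, rule w)
qed

text \<open>Every tangent vector is the velocity of a curve that stays in the space form for all times:
a normalised line on the sphere, a line in the hyperplane, and a line lifted to the graph on the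
hyperboloid. This makes gradients in the sense of \<^const>\<open>space_gradient\<close> unique.\<close>

lemma space_form_curve_exists:
  fixes q :: "'v::euclidean_space \<times> real"
  assumes \<kappa>: "\<kappa> \<in> {-1, 0, 1}" and q: "q \<in> space_form \<kappa>" and v: "v \<in> tangent_space \<kappa> q"
  obtains \<gamma> where "range \<gamma> \<subseteq> space_form \<kappa>" "\<gamma> 0 = q" "(\<gamma> has_vector_derivative v) (at (0::real))"
proof -
  consider "\<kappa> = 1" | "\<kappa> = 0" | "\<kappa> = -1" using \<kappa> by auto
  then show thesis
  proof cases
    case 1
    \<comment> \<open>By \<open>\<langle>q, v\<rangle> = 0\<close> this factor normalises \<open>q + t v\<close>.\<close>
    define n where "n t = inverse (sqrt (1 + t\<^sup>2 * (norm v)\<^sup>2))" for t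
    have pos: "1 + t\<^sup>2 * (norm v)\<^sup>2 > 0" for t :: real by (simp add: add_pos_nonneg)
    have form: "x \<in> space_form 1 \<longleftrightarrow> x \<bullet> x = 1" for x :: "'v \<times> real"
      by (auto simp: space_form_def inner_prod_def power2_eq_square add.commute)
    have qv: "q \<bullet> v = 0" "q \<bullet> q = 1"
      using q v form[of q] unfolding 1 by (simp_all add: tangent_space_def inner_prod_def add.commute)
    have dn: "(n has_real_derivative 0) (at 0)"
      unfolding n_def by (auto intro!: derivative_eq_intros)
    have "((\<lambda>t. n t *\<^sub>R (q + t *\<^sub>R v)) has_vector_derivative n 0 *\<^sub>R v + 0 *\<^sub>R (q + 0 *\<^sub>R v)) (at 0)"
      by (rule has_vector_derivative_scaleR[OF dn]) (auto intro!: derivative_eq_intros)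
    then have "((\<lambda>t. n t *\<^sub>R (q + t *\<^sub>R v)) has_vector_derivative v) (at 0)"
      by (simp add: n_def)
    moreover have "n t *\<^sub>R (q + t *\<^sub>R v) \<in> space_form \<kappa>" for t
    proof -
      have "(q + t *\<^sub>R v) \<bullet> (q + t *\<^sub>R v) = 1 + t\<^sup>2 * (norm v)\<^sup>2"
        unfolding power2_norm_eq_inner inner_add_left inner_add_right inner_commute[of "t *\<^sub>R v" q]
        by (simp add: qv power2_eq_square)
      then have "(n t *\<^sub>R (q + t *\<^sub>R v)) \<bullet> (n t *\<^sub>R (q + t *\<^sub>R v)) = (n t)\<^sup>2 * (1 + t\<^sup>2 * (norm v)\<^sup>2)"
        by (simp add: power2_eq_square)
      also have "\<dots> = 1" using pos[of t] by (simp add: n_def power_inverse)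
      finally show ?thesis unfolding 1 form .
    qed
    moreover have "n 0 *\<^sub>R (q + 0 *\<^sub>R v) = q" by (simp add: n_def)
    ultimately show thesis using that[of "\<lambda>t. n t *\<^sub>R (q + t *\<^sub>R v)"] by blast
  next
    case 2
    have "((\<lambda>t. q + t *\<^sub>R v) has_vector_derivative v) (at 0)"
      by (auto intro!: derivative_eq_intros)
    moreover have "q + t *\<^sub>R v \<in> space_form \<kappa>" for t
    proof -
      have "snd v = 0" "snd q = 1"
        using 2 q v tangent_space_height_zero[of q v] space_form_height_zero[of q] by simp_all
      then show ?thesis using 2 by (simp add: space_form_def)
    qed
    ultimately show thesis by (intro that[of "\<lambda>t. q + t *\<^sub>R v"]) auto
  next
    case 3
    define x where "x t = fst q + t *\<^sub>R fst v" for t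
    define h where "h t = sqrt (1 + x t \<bullet> x t)" for t
    have q2: "(snd q)\<^sup>2 = 1 + fst q \<bullet> fst q" "0 < snd q" and qv: "snd q * snd v = fst q \<bullet> fst v"
      using q v 3 by (auto simp: space_form_def tangent_space_def)
    have h0: "sqrt (1 + fst q \<bullet> fst q) = snd q" using q2 by (simp add: real_sqrt_unique)
    have pos: "0 < 1 + x t \<bullet> x t" for t by (simp add: add_pos_nonneg)
    have dx: "(x has_vector_derivative fst v) (at 0)"
      unfolding x_def by (auto intro!: derivative_eq_intros)
    have "((\<lambda>t. 1 + x t \<bullet> x t) has_real_derivative 2 * (fst q \<bullet> fst v)) (at 0)"
      unfolding x_def has_field_derivative_def
      by (auto intro!: derivative_eq_intros simp: inner_commute)
    from DERIV_chain2[where g = "\<lambda>t. 1 + x t \<bullet> x t", OF DERIV_real_sqrt[OF pos[of 0]] this]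
    have "(h has_real_derivative inverse (snd q) / 2 * (2 * (fst q \<bullet> fst v))) (at 0)"
      by (simp add: h_def[abs_def] x_def h0)
    then have "(h has_real_derivative snd v) (at 0)"
      using q2(2) by (simp add: qv[symmetric] flip: mult.assoc)
    then have "((\<lambda>t. (x t, h t)) has_vector_derivative (fst v, snd v)) (at 0)"
      using dx by (intro has_vector_derivative_Pair) (simp_all add: has_real_derivative_iff_has_vector_derivative)
    moreover have "(x t, h t) \<in> space_form \<kappa>" for t
      using pos[of t] 3 by (simp add: space_form_def h_def)
    ultimately show thesis
      by (intro that[of "\<lambda>t. (x t, h t)"]) (auto simp: x_def h_def h0)
  qed
qed

lemma differential_in_tangent_space:
  assumes acc: "axis_accessible x S" "x \<in> S" and F: "\<And>y. y \<in> S \<Longrightarrow> F y \<in> space_form \<kappa>"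
    and D: "(F has_derivative D) (at x within S)"
  shows "D v \<in> tangent_space \<kappa> (F x)"
proof -
  have f: "((\<lambda>y. fst (F y)) has_derivative (\<lambda>v. fst (D v))) (at x within S)"
    and s: "((\<lambda>y. snd (F y)) has_derivative (\<lambda>v. snd (D v))) (at x within S)"
    using has_derivative_fst[OF D] has_derivative_snd[OF D] by simp_all
  have "((\<lambda>y. snd (F y) * snd (F y) + \<kappa> * (fst (F y) \<bullet> fst (F y))) has_derivative
      (\<lambda>v. snd (F x) * snd (D v) + snd (D v) * snd (F x)
          + \<kappa> * (fst (F x) \<bullet> fst (D v) + fst (D v) \<bullet> fst (F x)))) (at x within S)"
    by (intro has_derivative_add has_derivative_mult has_derivative_mult_right has_derivative_inner f s)
  from axis_accessible_derivative_constant[OF acc this, of 1 v]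
  have "2 * (snd (F x) * snd (D v) + \<kappa> * (fst (F x) \<bullet> fst (D v))) = 0"
    using F by (simp add: space_form_def power2_eq_square inner_commute[of "fst (D v)"] algebra_simps)
  then show ?thesis by (simp add: tangent_space_def)
qed

section \<open>Distance spheres and the radial field\<close>

text \<open>Generalised cosine and sine: \<open>sn \<kappa>\<close> is the solution of \<open>y'' = - \<kappa> y\<close> with \<open>y(0) = 0\<close> and \<open>y'(0) = 1\<close>,
and \<open>cs \<kappa>\<close> is its derivative.\<close>

definition cs :: "real \<Rightarrow> real \<Rightarrow> real" where
  "cs \<kappa> t = (if \<kappa> = 1 then cos t else if \<kappa> = -1 then cosh t else 1)"

definition sn :: "real \<Rightarrow> real \<Rightarrow> real" where
  "sn \<kappa> t = (if \<kappa> = 1 then sin t else if \<kappa> = -1 then sinh t else t)"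

lemma ct_eq: "ct \<kappa> t = cs \<kappa> t / sn \<kappa> t"
  by (simp add: ct_def cs_def sn_def cot_def)

lemma sn_pos: "0 < t \<Longrightarrow> (\<kappa> = 1 \<Longrightarrow> t < pi) \<Longrightarrow> 0 < sn \<kappa> t"
  by (simp add: sn_def sin_gt_zero)

lemma cs_sn_squares: "\<kappa> \<in> {-1, 0, 1} \<Longrightarrow> (cs \<kappa> t)\<^sup>2 + \<kappa> * (sn \<kappa> t)\<^sup>2 = 1"
  by (auto simp: cs_def sn_def cosh_square_eq)

lemma cs_has_derivative:
  "\<kappa> \<in> {-1, 0, 1} \<Longrightarrow> (cs \<kappa> has_real_derivative - \<kappa> * sn \<kappa> t) (at t)"
  by (auto simp: cs_def[abs_def] sn_def intro!: derivative_eq_intros)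

text \<open>The antiderivative of \<open>sn \<kappa>\<close> vanishing at \<open>0\<close>. It is half the squared ambient chord between points at
distance \<open>t\<close>, see \<open>half_chord_sq_space_dist\<close>, so balls and spheres around \<open>p0\<close> are described by
the quadratic function \<open>\<langle>q - p0, q - p0\<rangle> / 2\<close> for all three values of \<open>\<kappa>\<close> at once.\<close>

definition half_chord_sq :: "real \<Rightarrow> real \<Rightarrow> real" where
  "half_chord_sq \<kappa> t = (if \<kappa> = 0 then t\<^sup>2 / 2 else \<kappa> * (1 - cs \<kappa> t))"

lemma half_chord_sq_has_derivative:
  assumes "\<kappa> \<in> {-1, 0, 1}" shows "(half_chord_sq \<kappa> has_real_derivative sn \<kappa> t) (at t)"
  using assms
  by (auto simp: half_chord_sq_def[abs_def] cs_def sn_def intro!: derivative_eq_intros)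

lemma half_chord_sq_mono:
  assumes "\<kappa> \<in> {-1, 0, 1}" "0 \<le> s" "s \<le> t" "\<kappa> = 1 \<Longrightarrow> t \<le> pi"
  shows "half_chord_sq \<kappa> s \<le> half_chord_sq \<kappa> t"
  using assms by (auto simp: half_chord_sq_def cs_def cos_mono_le_eq cosh_real_nonneg_le_iff)

text \<open>With \<open>hyperboloid_form_ge\<close>, this keeps \<^const>\<open>arccos\<close> and \<^const>\<open>arcosh\<close> in \<^const>\<open>space_dist\<close> on their proper domains.\<close>

lemma sphere_form_le:
  assumes "p \<in> space_form 1" "q \<in> space_form 1" shows "\<bar>ambient_form 1 p q\<bar> \<le> 1"
proof -
  have "ambient_form 1 p q = p \<bullet> q" "norm p = 1" "norm q = 1"
    using assms by (auto simp: ambient_form_def inner_prod_def space_form_def norm_eq_sqrt_inner power2_eq_square add.commute)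
  then show ?thesis using Cauchy_Schwarz_ineq2[of p q] by simp
qed

lemma hyperboloid_form_ge:
  assumes "p \<in> space_form (-1)" "q \<in> space_form (-1)" shows "1 \<le> - ambient_form (-1) p q"
proof -
  have p: "(snd p)\<^sup>2 = 1 + (norm (fst p))\<^sup>2" "0 < snd p" and q: "(snd q)\<^sup>2 = 1 + (norm (fst q))\<^sup>2" "0 < snd q"
    using assms by (auto simp: space_form_def power2_norm_eq_inner)
  have "(1 + norm (fst p) * norm (fst q))\<^sup>2 \<le> (1 + (norm (fst p))\<^sup>2) * (1 + (norm (fst q))\<^sup>2)"
    using zero_le_power2[of "norm (fst p) - norm (fst q)"] by (simp add: power2_eq_square algebra_simps)
  also have "\<dots> = (snd p * snd q)\<^sup>2" by (simp add: p q power_mult_distrib)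
  finally have "1 + norm (fst p) * norm (fst q) \<le> snd p * snd q"
    by (rule power2_le_imp_le) (use p q in simp)
  moreover have "fst p \<bullet> fst q \<le> norm (fst p) * norm (fst q)" by (rule norm_cauchy_schwarz)
  ultimately show ?thesis by (simp add: ambient_form_def)
qed

lemma space_dist_range:
  assumes \<kappa>: "\<kappa> \<in> {-1, 0, 1}" and "p \<in> space_form \<kappa>" "q \<in> space_form \<kappa>"
  shows "0 \<le> space_dist \<kappa> p q" "\<kappa> = 1 \<Longrightarrow> space_dist \<kappa> p q \<le> pi"
  using assms sphere_form_le[of p q] hyperboloid_form_ge[of p q]
  by (auto simp: space_dist_def abs_le_iff intro!: arccos_lbound arccos_ubound arcosh_nonneg_real)

lemma ambient_form_space_dist:
  assumes \<kappa>: "\<kappa> \<in> {-1, 1}" and p: "p \<in> space_form \<kappa>" and q: "q \<in> space_form \<kappa>"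
  shows "ambient_form \<kappa> p q = \<kappa> * cs \<kappa> (space_dist \<kappa> p q)"
  using \<kappa> sphere_form_le[of p q] hyperboloid_form_ge[of p q] p q
  by (auto simp: cs_def space_dist_def abs_le_iff cos_arccos)

lemma half_chord_sq_space_dist:
  assumes \<kappa>: "\<kappa> \<in> {-1, 0, 1}" and p: "p \<in> space_form \<kappa>" and q: "q \<in> space_form \<kappa>"
  shows "ambient_form \<kappa> (q - p) (q - p) / 2 = half_chord_sq \<kappa> (space_dist \<kappa> p q)"
proof -
  consider "\<kappa> = 1 \<or> \<kappa> = -1" | "\<kappa> = 0" using \<kappa> by auto
  then show ?thesis
  proof cases
    case 1
    then have pp: "ambient_form \<kappa> p p = \<kappa>" "ambient_form \<kappa> q q = \<kappa>"
      using position_form[OF \<kappa> p] position_form[OF \<kappa> q] by auto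
    have "ambient_form \<kappa> p q = \<kappa> * cs \<kappa> (space_dist \<kappa> p q)"
      using ambient_form_space_dist[OF _ p q] 1 by blast
    then show ?thesis using 1 pp
      by (auto simp: half_chord_sq_def ambient.diff_left ambient.diff_right ambient_form_commute[of _ q p])
  next
    case 2
    then have "snd p = 1" "snd q = 1" using space_form_height_zero[of p] space_form_height_zero[of q] p q by auto
    then show ?thesis using 2
      by (simp add: half_chord_sq_def space_dist_def ambient_form_def dist_prod_def dist_norm
          power2_norm_eq_inner norm_minus_commute[of "fst p"])
  qed
qed

lemma half_chord_sq_le:
  assumes "\<kappa> \<in> {-1, 0, 1}" "p0 \<in> space_form \<kappa>" "q \<in> geodesic_ball \<kappa> p0 R" "\<kappa> = 1 \<Longrightarrow> R < pi"
  shows "ambient_form \<kappa> (q - p0) (q - p0) / 2 \<le> half_chord_sq \<kappa> R"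
proof -
  have q: "q \<in> space_form \<kappa>" "space_dist \<kappa> p0 q \<le> R" using assms(3) by (auto simp: geodesic_ball_def)
  show ?thesis
    unfolding half_chord_sq_space_dist[OF assms(1,2) q(1)]
    by (rule half_chord_sq_mono[OF assms(1) space_dist_range(1)[OF assms(1,2) q(1)] q(2)])
      (use assms(4) in simp)
qed

text \<open>The vector \<open>cs(R) q - p0\<close> is the tangential part of \<open>- p0\<close> at \<open>q\<close> for \<open>\<kappa> = \<plusminus>1\<close> and the vector from \<open>p0\<close> to
\<open>q\<close> for \<open>\<kappa> = 0\<close>; in all cases it is \<open>sn(R)\<close> times the unit radial vector.\<close>

lemma sphere_normal:
  fixes p q :: "'v::euclidean_space \<times> real"
  assumes \<kappa>: "\<kappa> \<in> {-1, 0, 1}" and p: "p \<in> space_form \<kappa>" and q: "q \<in> space_form \<kappa>"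
    and R: "ambient_form \<kappa> (q - p) (q - p) / 2 = half_chord_sq \<kappa> R"
  shows "cs \<kappa> R *\<^sub>R q - p \<in> tangent_space \<kappa> q"
    and "ambient_form \<kappa> (cs \<kappa> R *\<^sub>R q - p) (cs \<kappa> R *\<^sub>R q - p) = (sn \<kappa> R)\<^sup>2"
proof -
  have exp: "ambient_form \<kappa> (q - p) (q - p) = ambient_form \<kappa> q q - 2 * ambient_form \<kappa> p q + ambient_form \<kappa> p p"
    by (simp add: ambient.diff_left ambient.diff_right ambient_form_commute[of _ q p])
  have norms: "ambient_form \<kappa> q q = \<kappa>" "ambient_form \<kappa> p p = \<kappa>" if "\<kappa> \<noteq> 0"
    using position_form[OF \<kappa> p] position_form[OF \<kappa> q] that by simp_all
  have B: "ambient_form \<kappa> p q = \<kappa> * cs \<kappa> R" if "\<kappa> \<noteq> 0"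
    using R that norms[OF that] unfolding exp by (simp add: half_chord_sq_def field_simps)
  have "snd q * snd p + \<kappa> * (fst q \<bullet> fst p) = cs \<kappa> R"
  proof (cases "\<kappa> = 0")
    case True
    then show ?thesis using p q space_form_height_zero[of p] space_form_height_zero[of q] by (simp add: cs_def)
  next
    case False
    then have "\<kappa> * ambient_form \<kappa> p q = cs \<kappa> R" using B \<kappa> by auto
    then show ?thesis using \<kappa> False by (auto simp: ambient_form_def inner_commute mult.commute)
  qed
  moreover have "snd q * snd q + \<kappa> * (fst q \<bullet> fst q) = 1" using q by (simp add: space_form_def power2_eq_square)
  moreover have "snd q * snd (cs \<kappa> R *\<^sub>R q - p) + \<kappa> * (fst q \<bullet> fst (cs \<kappa> R *\<^sub>R q - p))
      = cs \<kappa> R * (snd q * snd q + \<kappa> * (fst q \<bullet> fst q)) - (snd q * snd p + \<kappa> * (fst q \<bullet> fst p))"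
    by (simp add: inner_diff_right algebra_simps)
  ultimately show "cs \<kappa> R *\<^sub>R q - p \<in> tangent_space \<kappa> q"
    by (simp add: tangent_space_def)
  show "ambient_form \<kappa> (cs \<kappa> R *\<^sub>R q - p) (cs \<kappa> R *\<^sub>R q - p) = (sn \<kappa> R)\<^sup>2"
  proof (cases "\<kappa> = 0")
    case True
    then show ?thesis using R by (simp add: cs_def sn_def half_chord_sq_def)
  next
    case False
    have "ambient_form \<kappa> (cs \<kappa> R *\<^sub>R q - p) (cs \<kappa> R *\<^sub>R q - p)
        = (cs \<kappa> R)\<^sup>2 * ambient_form \<kappa> q q - 2 * cs \<kappa> R * ambient_form \<kappa> p q + ambient_form \<kappa> p p"
      by (simp add: ambient.diff_left ambient.diff_right ambient.scaleR_left ambient.scaleR_right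
          ambient_form_commute[of _ q p] power2_eq_square algebra_simps)
    also have "\<dots> = \<kappa> * (1 - (cs \<kappa> R)\<^sup>2)"
      by (simp add: norms[OF False] B[OF False] power2_eq_square algebra_simps)
    also have "\<dots> = \<kappa> * \<kappa> * (sn \<kappa> R)\<^sup>2" using cs_sn_squares[OF \<kappa>, of R]
      by (simp add: mult.assoc eq_diff_eq[symmetric] add.commute[of "(cs \<kappa> R)\<^sup>2"])
    finally show ?thesis using \<kappa> False by auto
  qed
qed

text \<open>Two gradients agree on velocities of curves, hence on their own difference, which is tangent; the form
is definite on tangent vectors.\<close>

lemma space_gradient_eqI:
  assumes \<kappa>: "\<kappa> \<in> {-1, 0, 1}" and q: "q \<in> space_form \<kappa>" and X: "X \<in> tangent_space \<kappa> q"
    and grad: "\<And>\<gamma> v. range \<gamma> \<subseteq> space_form \<kappa> \<Longrightarrow> \<gamma> 0 = q \<Longrightarrow> (\<gamma> has_vector_derivative v) (at (0::real))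
      \<Longrightarrow> v \<in> tangent_space \<kappa> q
      \<Longrightarrow> ((\<lambda>t. f (\<gamma> t)) has_real_derivative ambient_form \<kappa> X v) (at 0)"
  shows "space_gradient \<kappa> f q = X"
  unfolding space_gradient_def
proof (rule the_equality)
  show X': "X \<in> tangent_space \<kappa> q \<and> (\<forall>\<gamma> v. range \<gamma> \<subseteq> space_form \<kappa> \<and> \<gamma> 0 = q \<and>
      (\<gamma> has_vector_derivative v) (at (0::real)) \<longrightarrow>
           ((\<lambda>t. f (\<gamma> t)) has_real_derivative ambient_form \<kappa> X v) (at 0))"
  proof (intro conjI allI impI X; elim conjE)
    fix \<gamma> v assume a: "range \<gamma> \<subseteq> space_form \<kappa>" "\<gamma> 0 = q" "(\<gamma> has_vector_derivative v) (at (0::real))"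
    have "v \<in> tangent_space \<kappa> q"
      using differential_in_tangent_space[OF axis_accessible_UNIV UNIV_I, of \<gamma> \<kappa> "\<lambda>t. t *\<^sub>R v" 0 1] a
      by (auto simp: has_vector_derivative_def)
    from grad[OF a this] show "((\<lambda>t. f (\<gamma> t)) has_real_derivative ambient_form \<kappa> X v) (at 0)" .
  qed
  fix Y assume Y: "Y \<in> tangent_space \<kappa> q \<and> (\<forall>\<gamma> v. range \<gamma> \<subseteq> space_form \<kappa> \<and> \<gamma> 0 = q \<and>
      (\<gamma> has_vector_derivative v) (at (0::real)) \<longrightarrow>
           ((\<lambda>t. f (\<gamma> t)) has_real_derivative ambient_form \<kappa> Y v) (at 0))"
  have Z: "Y - X \<in> tangent_space \<kappa> q"
    using subspace_diff[OF subspace_tangent_space] X Y by blast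
  obtain \<gamma> where \<gamma>: "range \<gamma> \<subseteq> space_form \<kappa>" "\<gamma> 0 = q" "(\<gamma> has_vector_derivative Y - X) (at (0::real))"
    using space_form_curve_exists[OF \<kappa> q Z] .
  have "((\<lambda>t. f (\<gamma> t)) has_real_derivative ambient_form \<kappa> Y (Y - X)) (at 0)"
    "((\<lambda>t. f (\<gamma> t)) has_real_derivative ambient_form \<kappa> X (Y - X)) (at 0)"
    using Y X' \<gamma> by blast+
  then have "ambient_form \<kappa> Y (Y - X) = ambient_form \<kappa> X (Y - X)"
    by (rule DERIV_unique)
  then have "ambient_form \<kappa> (Y - X) (Y - X) = 0" by (simp add: ambient.diff_left)
  then have "Y - X = 0" by (rule tangent_form_definite[OF \<kappa> q Z])
  then show "Y = X" by simp
qed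

text \<open>For each \<open>\<kappa>\<close> the distance from \<open>p0\<close> is an elementary function of the ambient form, smooth at \<open>q\<close>
since \<open>q\<close> is neither \<open>p0\<close> nor its antipode; the chain rule gives the gradient.\<close>

lemma radial_field_eq:
  fixes p0 :: "'v::euclidean_space \<times> real"
  assumes \<kappa>: "\<kappa> \<in> {-1, 0, 1}" and p0: "p0 \<in> space_form \<kappa>" and q: "q \<in> space_form \<kappa>"
    and R: "space_dist \<kappa> p0 q = R" "0 < R" "\<kappa> = 1 \<Longrightarrow> R < pi"
  shows "radial_field \<kappa> p0 q = (1 / sn \<kappa> R) *\<^sub>R (cs \<kappa> R *\<^sub>R q - p0)"
  unfolding radial_field_def
proof (rule space_gradient_eqI[OF \<kappa> q])
  have sn: "sn \<kappa> R > 0" using sn_pos R by blast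
  have B: "ambient_form \<kappa> p0 q = \<kappa> * cs \<kappa> R" if "\<kappa> \<noteq> 0"
    using ambient_form_space_dist[OF _ p0 q] \<kappa> R(1) that by auto
  have chord: "ambient_form \<kappa> (q - p0) (q - p0) / 2 = half_chord_sq \<kappa> R"
    using half_chord_sq_space_dist[OF \<kappa> p0 q] R(1) by simp
  show "(1 / sn \<kappa> R) *\<^sub>R (cs \<kappa> R *\<^sub>R q - p0) \<in> tangent_space \<kappa> q"
    by (rule subspace_mul[OF subspace_tangent_space sphere_normal(1)[OF \<kappa> p0 q chord]])
  fix \<gamma> :: "real \<Rightarrow> 'v \<times> real" and v
  assume \<gamma>: "range \<gamma> \<subseteq> space_form \<kappa>" "\<gamma> 0 = q" "(\<gamma> has_vector_derivative v) (at 0)"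
    and v: "v \<in> tangent_space \<kappa> q"
  have eq: "ambient_form \<kappa> ((1 / sn \<kappa> R) *\<^sub>R (cs \<kappa> R *\<^sub>R q - p0)) v
      = (cs \<kappa> R * ambient_form \<kappa> q v - ambient_form \<kappa> p0 v) / sn \<kappa> R"
    by (simp add: ambient.scaleR_left ambient.diff_left)
  have d: "((\<lambda>t. ambient_form \<kappa> p0 (\<gamma> t)) has_real_derivative ambient_form \<kappa> p0 v) (at 0)"
    using bounded_linear.has_vector_derivative[OF ambient.bounded_linear_right \<gamma>(3)]
    by (simp add: has_real_derivative_iff_has_vector_derivative)
  consider "\<kappa> = 1" | "\<kappa> = 0" | "\<kappa> = -1" using \<kappa> by auto
  then show "((\<lambda>t. space_dist \<kappa> p0 (\<gamma> t)) has_real_derivative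
      ambient_form \<kappa> ((1 / sn \<kappa> R) *\<^sub>R (cs \<kappa> R *\<^sub>R q - p0)) v) (at 0)"
  proof cases
    case 1
    have b: "ambient_form \<kappa> p0 q = cos R" using B 1 by (simp add: cs_def)
    have "0 < sin R" using sn 1 by (simp add: sn_def)
    moreover have "sqrt (1 - (cos R)\<^sup>2) = sin R"
      using \<open>0 < sin R\<close> by (simp add: sin_squared_eq[symmetric])
    moreover have "-1 < cos R" "cos R < 1"
      using cos_monotone_0_pi[of 0 R] cos_monotone_0_pi[of R pi] R 1 by auto
    ultimately have arc: "(arccos has_real_derivative inverse (- sin R)) (at (ambient_form \<kappa> p0 (\<gamma> 0)))"
      using DERIV_arccos[of "cos R"] by (simp add: \<gamma>(2) b)
    have "((\<lambda>t. arccos (ambient_form \<kappa> p0 (\<gamma> t))) has_real_derivative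
        inverse (- sin R) * ambient_form \<kappa> p0 v) (at 0)"
      by (rule DERIV_chain2[where g = "\<lambda>t. ambient_form \<kappa> p0 (\<gamma> t)", OF arc d])
    then show ?thesis
      using position_orthogonal[OF \<kappa> v] 1 unfolding eq
      by (simp add: space_dist_def sn_def field_simps)
  next
    case 2
    have sq: "space_dist \<kappa> p0 x = sqrt (ambient_form \<kappa> (x - p0) (x - p0))" if "x \<in> space_form \<kappa>" for x
      using half_chord_sq_space_dist[OF \<kappa> p0 that] space_dist_range(1)[OF \<kappa> p0 that] 2
      by (simp add: half_chord_sq_def real_sqrt_unique)
    have BR: "sqrt (ambient_form \<kappa> (q - p0) (q - p0)) = R" using sq[OF q] R by simp
    have "((\<lambda>t. \<gamma> t - p0) has_vector_derivative v) (at 0)"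
      using \<gamma>(3) by (auto intro!: derivative_eq_intros)
    from ambient.has_vector_derivative[OF this this, of \<kappa>]
    have d': "((\<lambda>t. ambient_form \<kappa> (\<gamma> t - p0) (\<gamma> t - p0)) has_real_derivative
        2 * ambient_form \<kappa> (q - p0) v) (at 0)"
      by (simp add: has_real_derivative_iff_has_vector_derivative \<gamma>(2) ambient_form_commute[of _ v])
    have pos: "0 < ambient_form \<kappa> (q - p0) (q - p0)" using BR R(2) real_sqrt_gt_0_iff by metis
    have "((\<lambda>t. sqrt (ambient_form \<kappa> (\<gamma> t - p0) (\<gamma> t - p0))) has_real_derivative
        inverse R / 2 * (2 * ambient_form \<kappa> (q - p0) v)) (at 0)"
      using DERIV_chain2[where g = "\<lambda>t. ambient_form \<kappa> (\<gamma> t - p0) (\<gamma> t - p0)", OF DERIV_real_sqrt d'] pos \<gamma>(2) BR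
      by simp
    moreover have "(\<lambda>t. sqrt (ambient_form \<kappa> (\<gamma> t - p0) (\<gamma> t - p0))) = (\<lambda>t. space_dist \<kappa> p0 (\<gamma> t))"
      by (rule ext, rule sq[symmetric]) (use \<gamma>(1) in blast)
    moreover have "inverse R / 2 * (2 * y) = y / R" for y
      by (simp add: inverse_eq_divide)
    moreover have "(cs \<kappa> R * ambient_form \<kappa> q v - ambient_form \<kappa> p0 v) / sn \<kappa> R
        = ambient_form \<kappa> (q - p0) v / R"
      by (simp only: 2 sn_def cs_def ambient.diff_left) simp
    ultimately show ?thesis
      unfolding eq by simp
  next
    case 3
    have b: "- ambient_form \<kappa> p0 q = cosh R" using B 3 by (simp add: cs_def)
    have "0 < sinh R" using sn 3 by (simp add: sn_def)
    moreover have "sqrt ((cosh R)\<^sup>2 - 1) = sinh R"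
      using \<open>0 < sinh R\<close> by (simp add: cosh_square_eq)
    moreover have "1 < cosh R"
      using cosh_real_nonneg_less_iff[of 0 R] R by simp
    ultimately have arc: "(arcosh has_real_derivative 1 / sinh R) (at (- ambient_form \<kappa> p0 (\<gamma> 0)))"
      using arcosh_real_has_field_derivative[of "cosh R"] by (simp add: \<gamma>(2) b)
    have "((\<lambda>t. arcosh (- ambient_form \<kappa> p0 (\<gamma> t))) has_real_derivative
        1 / sinh R * - ambient_form \<kappa> p0 v) (at 0)"
      by (rule DERIV_chain2[where g = "\<lambda>t. - ambient_form \<kappa> p0 (\<gamma> t)", OF arc DERIV_minus[OF d]])
    then show ?thesis
      using position_orthogonal[OF \<kappa> v] 3 unfolding eq
      by (simp add: space_dist_def sn_def)
  qed
qed

lemma sphere_normal_orthogonal: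
  assumes "\<kappa> \<in> {-1, 0, 1}" "p0 \<in> space_form \<kappa>" "q \<in> geodesic_sphere \<kappa> p0 R" "0 < R" "\<kappa> = 1 \<Longrightarrow> R < pi"
    and "ambient_form \<kappa> v (radial_field \<kappa> p0 q) = 0"
  shows "ambient_form \<kappa> v (cs \<kappa> R *\<^sub>R q - p0) = 0"
proof -
  have "radial_field \<kappa> p0 q = (1 / sn \<kappa> R) *\<^sub>R (cs \<kappa> R *\<^sub>R q - p0)"
    by (rule radial_field_eq) (use assms in \<open>auto simp: geodesic_sphere_def\<close>)
  moreover have "0 < sn \<kappa> R" using sn_pos assms(4,5) by blast
  ultimately show ?thesis using assms(6) by (simp add: ambient.scaleR_right)
qed

section \<open>The family in a boundary chart\<close>

text \<open>A chart representation of the family near a boundary point \<open>(a, x)\<close>: \<open>G\<close> and \<open>N\<close> are extensions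
of the immersions and of their unit normals to an open set \<open>W\<close>, and they satisfy the geometric
conditions only on the part of \<open>W\<close> that belongs to the family. Balls and spheres are expressed by the
chord function \<open>q \<mapsto> \<langle>q - p0, q - p0\<rangle> / 2\<close>, and the free boundary condition by the explicit normal
\<open>cs(r) G - p0\<close> of the sphere.\<close>

locale free_boundary_chart =
  fixes \<kappa> :: real and p0 :: "'v::euclidean_space \<times> real"
    and I :: "real set" and U :: "'e::euclidean_space set" and W :: "(real \<times> 'e) set"
    and r :: "real \<Rightarrow> real" and G N :: "real \<times> 'e \<Rightarrow> 'v \<times> real"
    and a r' :: real and x \<eta> :: 'e
  assumes curvature: "\<kappa> \<in> {-1, 0, 1}" and hypersurface: "DIM('v) = DIM('e) + 1"
    and centre: "p0 \<in> space_form \<kappa>"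
    and interval: "is_interval I" "interior I \<noteq> {}"
    and U: "openin (top_of_set half_space) U" and W: "open W"
    and smooth_G: "Ck_on (Suc (Suc 0)) W G" and smooth_N: "Ck_on (Suc (Suc 0)) W N"
    and radius: "\<And>s. s \<in> I \<Longrightarrow> 0 < r s" "\<And>s. s \<in> I \<Longrightarrow> \<kappa> = 1 \<Longrightarrow> r s < pi"
    and position: "\<And>z. z \<in> (I \<times> U) \<inter> W \<Longrightarrow> G z \<in> space_form \<kappa>"
    and normal_tangent: "\<And>z. z \<in> (I \<times> U) \<inter> W \<Longrightarrow> N z \<in> tangent_space \<kappa> (G z)"
    and normal_unit: "\<And>z. z \<in> (I \<times> U) \<inter> W \<Longrightarrow> ambient_form \<kappa> (N z) (N z) = 1"
    and normal_orthogonal: "\<And>z w. z \<in> (I \<times> U) \<inter> W \<Longrightarrow> ambient_form \<kappa> (N z) (dir_deriv G z (0, w)) = 0"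
    and in_ball: "\<And>s y. (s, y) \<in> (I \<times> U) \<inter> W \<Longrightarrow>
      ambient_form \<kappa> (G (s, y) - p0) (G (s, y) - p0) / 2 \<le> half_chord_sq \<kappa> (r s)"
    and on_sphere: "\<And>s y. (s, y) \<in> (I \<times> U) \<inter> W \<Longrightarrow> y \<bullet> inward_dir = 0 \<Longrightarrow>
      ambient_form \<kappa> (G (s, y) - p0) (G (s, y) - p0) / 2 = half_chord_sq \<kappa> (r s)"
    and free_boundary: "\<And>s y. (s, y) \<in> (I \<times> U) \<inter> W \<Longrightarrow> y \<bullet> inward_dir = 0 \<Longrightarrow>
      ambient_form \<kappa> (N (s, y)) (cs \<kappa> (r s) *\<^sub>R G (s, y) - p0) = 0"
    and base: "a \<in> I" "x \<in> U" "(a, x) \<in> W" "x \<bullet> inward_dir = 0"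
    and immersed: "inj (\<lambda>w. dir_deriv G (a, x) (0, w))"
    and radius_deriv: "(r has_real_derivative r') (at a within I)"
    and outward: "\<eta> \<bullet> inward_dir < 0"
    and conormal_unit: "ambient_form \<kappa> (dir_deriv G (a, x) (0, \<eta>)) (dir_deriv G (a, x) (0, \<eta>)) = 1"
    and conormal_orthogonal: "\<And>u. u \<bullet> inward_dir = 0 \<Longrightarrow>
      ambient_form \<kappa> (dir_deriv G (a, x) (0, \<eta>)) (dir_deriv G (a, x) (0, u)) = 0"
begin

abbreviation form :: "'v \<times> real \<Rightarrow> 'v \<times> real \<Rightarrow> real" where "form \<equiv> ambient_form \<kappa>"
abbreviation "z \<equiv> (a, x)"
text \<open>The differential of the immersion, the velocity of the family, and the radial vector, the last one
scaled by \<open>sn(r)\<close>.\<close>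

definition "P w = dir_deriv G z (0, w)"
definition "V = dir_deriv G z (1, 0)"
abbreviation "n \<equiv> N z"
abbreviation "q \<equiv> G z"
definition "X = cs \<kappa> (r a) *\<^sub>R q - p0"

lemma zS: "z \<in> (I \<times> U) \<inter> W"
  using base by simp

lemma accessible: "axis_accessible z ((I \<times> U) \<inter> W)"
  by (intro axis_accessible_Int_open axis_accessible_Times interval_approachable axis_accessible_half_space_open interval base U W)

lemma limit: "at a within I \<noteq> bot"
  by (intro interval_approachable interval base)

lemma G_deriv: "(G has_derivative dir_deriv G z) (at z)"
  by (rule Ck_on_has_derivative[OF smooth_G W base(3)])

lemma N_deriv: "(N has_derivative dir_deriv N z) (at z)"
  by (rule Ck_on_has_derivative[OF smooth_N W base(3)])

lemma DG_deriv: "((\<lambda>y. dir_deriv G y v) has_derivative dir_deriv (\<lambda>y. dir_deriv G y v) z) (at z)"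
  by (rule Ck_on_has_derivative[of 0 W, OF _ W base(3)]) (use smooth_G Ck_on.simps(2)[of "Suc 0" W G] in blast)

lemma linear_P: "linear P"
proof (rule linearI)
  note lin = has_derivative_linear[OF G_deriv]
  show "P (u + w) = P u + P w" for u w
    using linear_add[OF lin, of "(0, u)" "(0, w)"] by (simp add: P_def)
  show "P (c *\<^sub>R w) = c *\<^sub>R P w" for c w
    using linear_cmul[OF lin, of c "(0, w)"] by (simp add: P_def)
qed

lemma tangent_G: "dir_deriv G z v \<in> tangent_space \<kappa> q"
  by (rule differential_in_tangent_space[OF accessible zS position has_derivative_at_withinI[OF G_deriv]])

lemma tangent_P: "P w \<in> tangent_space \<kappa> q" and tangent_V: "V \<in> tangent_space \<kappa> q"
  by (simp_all add: P_def V_def tangent_G)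

lemma n_facts: "n \<in> tangent_space \<kappa> q" "form n n = 1" "form n (P w) = 0"
  using zS normal_tangent normal_unit normal_orthogonal by (auto simp: P_def)

text \<open>Differentiates \<open>\<langle>\<nu>, d\<Phi>(w)\<rangle> = 0\<close>. Combined with Schwarz's theorem, space directions \<open>v\<close> give the symmetry
of the second fundamental form, and the time direction moves the derivative from \<open>V\<close> to \<open>\<nu>\<close>.\<close>

lemma normal_orthogonal_deriv:
  "form (dir_deriv N z v) (P w) + form n (dir_deriv (\<lambda>y. dir_deriv G y (0, w)) z v) = 0"
proof -
  have "((\<lambda>y. form (N y) (dir_deriv G y (0, w))) has_derivative
      (\<lambda>v. form n (dir_deriv (\<lambda>y. dir_deriv G y (0, w)) z v) + form (dir_deriv N z v) (dir_deriv G z (0, w)))) (at z)"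
    by (rule ambient.FDERIV[OF N_deriv DG_deriv])
  from axis_accessible_derivative_constant[OF accessible zS has_derivative_at_withinI[OF this], of 0 v]
  show ?thesis using normal_orthogonal by (simp add: P_def add.commute)
qed

lemma normal_unit_deriv: "form n (dir_deriv N z v) = 0"
proof -
  have "((\<lambda>y. form (N y) (N y)) has_derivative (\<lambda>v. form n (dir_deriv N z v) + form (dir_deriv N z v) n)) (at z)"
    by (rule ambient.FDERIV[OF N_deriv N_deriv])
  from axis_accessible_derivative_constant[OF accessible zS has_derivative_at_withinI[OF this], of 1 v]
  show ?thesis using normal_unit by (simp add: ambient_form_commute[of \<kappa> "dir_deriv N z v" n])
qed

text \<open>Replaces \<open>X\<close> by the gradient \<open>q - p0\<close> of the chord function: for \<open>\<kappa> = \<plusminus>1\<close> the two differ by a multiple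
of \<open>q\<close>, which is orthogonal to tangent vectors, and for \<open>\<kappa> = 0\<close> they coincide.\<close>

lemma form_X: "Y \<in> tangent_space \<kappa> q \<Longrightarrow> form X Y = form (q - p0) Y"
  using position_orthogonal[OF curvature, of Y q] curvature
  by (auto simp: X_def ambient.diff_left ambient.scaleR_left cs_def)

lemma X_facts: "X \<in> tangent_space \<kappa> q" "form X X = (sn \<kappa> (r a))\<^sup>2"
  using sphere_normal[OF curvature centre position[OF zS] on_sphere[OF zS base(4)]] by (simp_all add: X_def)

lemma sn_positive: "0 < sn \<kappa> (r a)"
  using sn_pos radius base(1) by blast

lemma boundary_line:
  obtains e where "0 < e" "\<And>t. 0 \<le> t * (w \<bullet> inward_dir) \<Longrightarrow> \<bar>t\<bar> < e \<Longrightarrow> (a, x + t *\<^sub>R w) \<in> (I \<times> U) \<inter> W"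
proof -
  obtain e1 where e1: "0 < e1" "\<And>t. \<bar>t\<bar> < e1 \<Longrightarrow> 0 \<le> x \<bullet> inward_dir + t * (w \<bullet> inward_dir) \<Longrightarrow> x + t *\<^sub>R w \<in> U"
    using half_space_open_line[OF U base(2), of w] by blast
  obtain k where k: "0 < k" "ball z k \<subseteq> W" using W base(3) open_contains_ball by blast
  have "0 < k / (norm w + 1)" using k by (simp add: add_nonneg_pos)
  moreover have "(a, x + t *\<^sub>R w) \<in> W" if "\<bar>t\<bar> < k / (norm w + 1)" for t
  proof -
    have "\<bar>t\<bar> * (norm w + 1) < k" using that by (simp add: pos_less_divide_eq add_nonneg_pos)
    then have "dist z (a, x + t *\<^sub>R w) < k"
      using abs_ge_zero[of t] by (simp add: dist_prod_def dist_norm distrib_left)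
    then show ?thesis using k by auto
  qed
  ultimately show thesis using e1 base
    by (intro that[of "min e1 (k / (norm w + 1))"]) auto
qed

lemma line_G: "((\<lambda>t. G (a, x + t *\<^sub>R w)) has_vector_derivative P w) (at (0::real))"
  using has_derivative_along_line[OF G_deriv, of "(0, w)"] by (simp add: P_def)

lemma line_N: "((\<lambda>t. N (a, x + t *\<^sub>R w)) has_vector_derivative dir_deriv N z (0, w)) (at (0::real))"
  using has_derivative_along_line[OF N_deriv, of "(0, w)"] by simp

lemma line_chord:
  "((\<lambda>t. form (G (a, x + t *\<^sub>R w) - p0) (G (a, x + t *\<^sub>R w) - p0) / 2) has_real_derivative form X (P w)) (at 0)"
proof -
  have "((\<lambda>t. G (a, x + t *\<^sub>R w) - p0) has_vector_derivative P w) (at 0)"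
    using line_G[of w] by (auto intro!: derivative_eq_intros)
  from ambient.has_vector_derivative[OF this this, of \<kappa>]
  have "((\<lambda>t. form (G (a, x + t *\<^sub>R w) - p0) (G (a, x + t *\<^sub>R w) - p0)) has_real_derivative
      2 * form (q - p0) (P w)) (at 0)"
    by (simp add: has_real_derivative_iff_has_vector_derivative ambient_form_commute[of _ "P w"])
  from DERIV_cdivide[OF this, of 2] show ?thesis by (simp add: form_X[OF tangent_P])
qed

text \<open>Along the boundary the chord function is constant.\<close>

lemma sphere_tangent:
  assumes u: "u \<bullet> inward_dir = 0"
  shows "form X (P u) = 0"
proof -
  obtain e where e: "0 < e" "\<And>t. 0 \<le> t * (u \<bullet> inward_dir) \<Longrightarrow> \<bar>t\<bar> < e \<Longrightarrow> (a, x + t *\<^sub>R u) \<in> (I \<times> U) \<inter> W"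
    using boundary_line[of u] by blast
  have "((\<lambda>_. half_chord_sq \<kappa> (r a)) has_real_derivative form X (P u)) (at 0)"
    by (rule has_field_derivative_transform_within[OF line_chord e(1) UNIV_I])
      (use e(2) u on_sphere base(4) in \<open>auto simp: inner_add_left\<close>)
  then show ?thesis using DERIV_unique DERIV_const by blast
qed

text \<open>Differentiating the free boundary condition along the boundary. The radius is fixed there, so the only
other term is \<open>cs(r) \<langle>\<nu>, d\<Phi>(u)\<rangle> = 0\<close>.\<close>

lemma free_boundary_tangent:
  assumes u: "u \<bullet> inward_dir = 0"
  shows "form (dir_deriv N z (0, u)) X = 0"
proof -
  obtain e where e: "0 < e" "\<And>t. 0 \<le> t * (u \<bullet> inward_dir) \<Longrightarrow> \<bar>t\<bar> < e \<Longrightarrow> (a, x + t *\<^sub>R u) \<in> (I \<times> U) \<inter> W"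
    using boundary_line[of u] by blast
  have "((\<lambda>t. cs \<kappa> (r a) *\<^sub>R G (a, x + t *\<^sub>R u) - p0) has_vector_derivative cs \<kappa> (r a) *\<^sub>R P u) (at 0)"
    using line_G[of u] by (auto intro!: derivative_eq_intros)
  from ambient.has_vector_derivative[OF line_N[of u] this, of \<kappa>]
  have "((\<lambda>t. form (N (a, x + t *\<^sub>R u)) (cs \<kappa> (r a) *\<^sub>R G (a, x + t *\<^sub>R u) - p0)) has_real_derivative
      form (dir_deriv N z (0, u)) X) (at 0)"
    by (simp add: has_real_derivative_iff_has_vector_derivative X_def ambient.scaleR_right n_facts)
  then have "((\<lambda>_. 0) has_real_derivative form (dir_deriv N z (0, u)) X) (at 0)"
    by (rule has_field_derivative_transform_within[OF _ e(1) UNIV_I])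
      (use e(2) u free_boundary base(4) in \<open>auto simp: inner_add_left\<close>)
  then show ?thesis using DERIV_unique DERIV_const by blast
qed

text \<open>Otherwise the chord would exceed that of the sphere when entering the hypersurface along \<open>- \<eta>\<close>.\<close>

lemma conormal_points_outward: "0 \<le> form X (P \<eta>)"
proof (rule ccontr)
  assume "\<not> 0 \<le> form X (P \<eta>)"
  then have neg: "0 < form X (P (- \<eta>))"
    by (simp add: linear_neg[OF linear_P] ambient.minus_right)
  obtain e where e: "0 < e" "\<And>t. 0 \<le> t * (- \<eta> \<bullet> inward_dir) \<Longrightarrow> \<bar>t\<bar> < e \<Longrightarrow> (a, x + t *\<^sub>R (- \<eta>)) \<in> (I \<times> U) \<inter> W"
    using boundary_line[of "- \<eta>"] by blast
  obtain d where d: "0 < d" "\<And>h. 0 < h \<Longrightarrow> h < d \<Longrightarrow>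
      form (q - p0) (q - p0) / 2 < form (G (a, x + h *\<^sub>R (- \<eta>)) - p0) (G (a, x + h *\<^sub>R (- \<eta>)) - p0) / 2"
    using DERIV_pos_inc_right[OF line_chord neg] by auto
  define h where "h = min e d / 2"
  have h: "0 < h" "h < e" "h < d" using e(1) d(1) by (auto simp: h_def)
  have "(a, x + h *\<^sub>R (- \<eta>)) \<in> (I \<times> U) \<inter> W"
    by (rule e(2)) (use h outward in \<open>auto intro: mult_nonneg_nonpos\<close>)
  from in_ball[OF this] d(2)[OF h(1,3)] on_sphere[OF zS base(4)] show False by linarith
qed

text \<open>The vector \<open>X\<close> is orthogonal to \<open>\<nu>\<close> and hence of the form \<open>d\<Phi>(w)\<close>; as it is also orthogonal to the
boundary, it is a multiple of \<open>d\<Phi>(\<eta>)\<close>. Its length fixes the factor up to sign, and the ball condition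
fixes the sign.\<close>

lemma conormal_is_radial: "X = sn \<kappa> (r a) *\<^sub>R P \<eta>"
proof -
  obtain w where "X = form X n *\<^sub>R n + P w"
    by (rule tangent_decomposition[OF curvature position[OF zS] hypersurface linear_P _ _ n_facts X_facts(1)])
      (use immersed tangent_P in \<open>auto simp: P_def[abs_def]\<close>)
  moreover have "form X n = 0"
    using free_boundary[OF zS base(4)] by (simp add: X_def ambient_form_commute)
  ultimately have Xw: "X = P w" by simp
  \<comment> \<open>Split \<open>w\<close> into a multiple of \<open>\<eta>\<close> and a vector tangent to the boundary.\<close>
  define c where "c = (w \<bullet> inward_dir) / (\<eta> \<bullet> inward_dir)"
  define u where "u = w - c *\<^sub>R \<eta>"
  have u: "u \<bullet> inward_dir = 0" using outward by (simp add: u_def c_def inner_diff_left)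
  have Pu: "P u = X - c *\<^sub>R P \<eta>"
    by (simp add: u_def Xw linear_diff[OF linear_P] linear_cmul[OF linear_P])
  have "form (P u) (P u) = form X (P u) - c * form (P \<eta>) (P u)"
    by (subst (1) Pu) (simp add: ambient.diff_left ambient.scaleR_left)
  also have "\<dots> = 0" using sphere_tangent[OF u] conormal_orthogonal[OF u] by (simp add: P_def)
  finally have "P u = 0" by (rule tangent_form_definite[OF curvature position[OF zS] tangent_P])
  then have X: "X = c *\<^sub>R P \<eta>" using Pu by simp
  have "form X X = c\<^sup>2" "form X (P \<eta>) = c"
    using conormal_unit by (simp_all add: X ambient.scaleR_left ambient.scaleR_right P_def power2_eq_square)
  then have "c\<^sup>2 = (sn \<kappa> (r a))\<^sup>2" "0 \<le> c"
    using X_facts(2) conormal_points_outward by simp_all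
  then have "c = sn \<kappa> (r a)" using sn_positive by (simp add: power2_eq_iff_nonneg)
  with X show ?thesis by simp
qed

lemma time_near:
  obtains e where "0 < e" "\<And>s. s \<in> I \<Longrightarrow> dist s a < e \<Longrightarrow> (s, x) \<in> (I \<times> U) \<inter> W"
  using open_slices[OF W base(3)] base(2) by (metis IntI mem_Sigma_iff)

text \<open>The boundary point remains on the sphere of radius \<open>r(s)\<close>, so the chord function along its path is
\<^term>\<open>half_chord_sq \<kappa> (r s)\<close>, whose derivative is \<open>sn(r) r'\<close>.\<close>

lemma radial_velocity: "form X V = sn \<kappa> (r a) * r'"
proof -
  obtain e where e: "0 < e" "\<And>s. s \<in> I \<Longrightarrow> dist s a < e \<Longrightarrow> (s, x) \<in> (I \<times> U) \<inter> W"
    using time_near by blast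
  have "((\<lambda>s. G (s, x) - p0) has_vector_derivative V) (at a within I)"
    using has_derivative_time_slice[OF G_deriv] by (auto simp: V_def intro!: derivative_eq_intros)
  from ambient.has_vector_derivative[OF this this, of \<kappa>]
  have "((\<lambda>s. form (G (s, x) - p0) (G (s, x) - p0)) has_real_derivative 2 * form (q - p0) V) (at a within I)"
    by (simp add: has_real_derivative_iff_has_vector_derivative ambient_form_commute[of _ V])
  from DERIV_cdivide[OF this, of 2]
  have "((\<lambda>s. form (G (s, x) - p0) (G (s, x) - p0) / 2) has_real_derivative form X V) (at a within I)"
    by (simp add: form_X[OF tangent_V])
  then have "((\<lambda>s. half_chord_sq \<kappa> (r s)) has_real_derivative form X V) (at a within I)"
    by (rule has_field_derivative_transform_within[OF _ e(1) base(1)])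
      (use e(2) on_sphere base(4) in blast)
  moreover have "((\<lambda>s. half_chord_sq \<kappa> (r s)) has_real_derivative sn \<kappa> (r a) * r') (at a within I)"
    by (rule DERIV_chain2[where g = r, OF half_chord_sq_has_derivative[OF curvature] radius_deriv])
  ultimately show ?thesis by (rule has_field_derivative_unique[OF _ _ limit])
qed

text \<open>Differentiating the free boundary condition in the parameter. The change of the radius enters only
through \<open>- \<kappa> sn(r) r' \<langle>\<nu>, q\<rangle>\<close>, which vanishes because \<open>\<nu>\<close> is tangent to the space form.\<close>

lemma free_boundary_velocity:
  "form (dir_deriv N z (1, 0)) X + cs \<kappa> (r a) * form n V = 0"
proof -
  obtain e where e: "0 < e" "\<And>s. s \<in> I \<Longrightarrow> dist s a < e \<Longrightarrow> (s, x) \<in> (I \<times> U) \<inter> W"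
    using time_near by blast
  have "((\<lambda>s. cs \<kappa> (r s)) has_real_derivative - \<kappa> * sn \<kappa> (r a) * r') (at a within I)"
    by (rule DERIV_chain2[where g = r, OF cs_has_derivative[OF curvature] radius_deriv])
  from has_vector_derivative_diff[OF has_vector_derivative_scaleR[OF this has_derivative_time_slice[OF G_deriv]] has_vector_derivative_const[of p0]]
  have "((\<lambda>s. cs \<kappa> (r s) *\<^sub>R G (s, x) - p0) has_vector_derivative
      cs \<kappa> (r a) *\<^sub>R V + (- \<kappa> * sn \<kappa> (r a) * r') *\<^sub>R q) (at a within I)"
    by (simp add: V_def)
  from ambient.has_vector_derivative[OF has_derivative_time_slice[OF N_deriv] this, of \<kappa>]
  have "((\<lambda>s. form (N (s, x)) (cs \<kappa> (r s) *\<^sub>R G (s, x) - p0)) has_real_derivative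
      form n (cs \<kappa> (r a) *\<^sub>R V + (- \<kappa> * sn \<kappa> (r a) * r') *\<^sub>R q) + form (dir_deriv N z (1, 0)) X) (at a within I)"
    by (simp add: has_real_derivative_iff_has_vector_derivative X_def)
  then have "((\<lambda>_. 0) has_real_derivative
      form n (cs \<kappa> (r a) *\<^sub>R V + (- \<kappa> * sn \<kappa> (r a) * r') *\<^sub>R q) + form (dir_deriv N z (1, 0)) X) (at a within I)"
    by (rule has_field_derivative_transform_within[OF _ e(1) base(1)])
      (use e(2) free_boundary base(4) in blast)
  then have "form n (cs \<kappa> (r a) *\<^sub>R V + (- \<kappa> * sn \<kappa> (r a) * r') *\<^sub>R q) + form (dir_deriv N z (1, 0)) X = 0"
    using has_field_derivative_unique[OF _ DERIV_const limit] by blast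
  moreover have "\<kappa> * form n q = 0"
    using position_orthogonal[OF curvature n_facts(1)] by (simp add: ambient_form_commute)
  then have "(- \<kappa> * sn \<kappa> (r a) * r') * form n q = 0" by auto
  ultimately show ?thesis
    by (simp only: ambient.add_right ambient.scaleR_right real_scaleR_def)
qed

lemma shape_operator_symmetric:
  "form (dir_deriv N z (0, u)) (P w) = form (dir_deriv N z (0, w)) (P u)"
  using normal_orthogonal_deriv[of "(0, u)" w] normal_orthogonal_deriv[of "(0, w)" u]
    mixed_derivatives_commute[OF smooth_G W base(3), of "(0, w)" "(0, u)"] by simp

text \<open>The identity in coordinates: the first two summands are the product rule for \<open>\<partial>\<^sub>\<eta>\<langle>V, \<nu>\<rangle>\<close>.\<close>

lemma boundary_identity:
  "form V (dir_deriv N z (0, \<eta>)) + form (dir_deriv (\<lambda>y. dir_deriv G y (1, 0)) z (0, \<eta>)) n - ct \<kappa> (r a) * form V n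
   = r' * form (dir_deriv N z (0, \<eta>)) (P \<eta>)"
proof -
  define S where "S = sn \<kappa> (r a)"
  have S: "0 < S" using sn_positive by (simp add: S_def)
  have X: "X = S *\<^sub>R P \<eta>" using conormal_is_radial by (simp add: S_def)
  have "form n (dir_deriv (\<lambda>y. dir_deriv G y (1, 0)) z (0, \<eta>)) = - form (dir_deriv N z (1, 0)) (P \<eta>)"
    using normal_orthogonal_deriv[of "(1, 0)" \<eta>]
      mixed_derivatives_commute[OF smooth_G W base(3), of "(1, 0)" "(0, \<eta>)"] by simp
  moreover have "S * form (dir_deriv N z (1, 0)) (P \<eta>) = - cs \<kappa> (r a) * form n V"
    using free_boundary_velocity by (simp add: X ambient.scaleR_right)
  then have "form (dir_deriv N z (1, 0)) (P \<eta>) = - ct \<kappa> (r a) * form n V"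
    using S by (simp add: ct_eq S_def field_simps)
  ultimately have first: "form (dir_deriv (\<lambda>y. dir_deriv G y (1, 0)) z (0, \<eta>)) n = ct \<kappa> (r a) * form V n"
    by (simp add: ambient_form_commute)
  obtain w where Vw: "V = form V n *\<^sub>R n + P w"
    by (rule tangent_decomposition[OF curvature position[OF zS] hypersurface linear_P _ _ n_facts tangent_V])
      (use immersed tangent_P in \<open>auto simp: P_def[abs_def]\<close>)
  \<comment> \<open>Split \<open>w\<close> into a multiple of \<open>\<eta>\<close> and a vector tangent to the boundary.\<close>
  define c where "c = (w \<bullet> inward_dir) / (\<eta> \<bullet> inward_dir)"
  define u where "u = w - c *\<^sub>R \<eta>"
  have u: "u \<bullet> inward_dir = 0" using outward by (simp add: u_def c_def inner_diff_left)
  have Pw: "P w = c *\<^sub>R P \<eta> + P u"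
    by (simp add: u_def linear_diff[OF linear_P] linear_cmul[OF linear_P])
  have "form (P \<eta>) V = form V n * form (P \<eta>) n + c * form (P \<eta>) (P \<eta>) + form (P \<eta>) (P u)"
    by (subst Vw) (simp add: Pw ambient.add_right ambient.scaleR_right)
  also have "\<dots> = c"
    using conormal_unit conormal_orthogonal[OF u] n_facts(3)[of \<eta>]
    by (simp add: ambient_form_commute[of _ "P \<eta>" n] P_def[symmetric])
  finally have "c = r'"
    using radial_velocity S by (simp add: X ambient.scaleR_left S_def[symmetric])
  have "form (P u) (dir_deriv N z (0, \<eta>)) = 0"
    using shape_operator_symmetric[of \<eta> u] free_boundary_tangent[OF u] S
    by (simp add: X ambient.scaleR_right ambient_form_commute[of _ "P u"])
  then have "form V (dir_deriv N z (0, \<eta>)) = r' * form (P \<eta>) (dir_deriv N z (0, \<eta>))"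
    by (subst Vw) (simp add: Pw \<open>c = r'\<close> ambient.add_left ambient.scaleR_left normal_unit_deriv)
  with first show ?thesis by (simp add: ambient_form_commute)
qed

end

section \<open>The boundary identity\<close>

text \<open>It remains to pass to a chart around the boundary point. The smooth extensions of \<open>\<Phi>\<close> and \<open>\<nu>\<close> in it
satisfy the conditions collected above, and derivatives on the manifold, within \<open>I\<close> or within the chart
image, are slices of the full derivatives of the extensions.\<close>

theorem theoremB:
  fixes \<kappa> :: real
    and p0 :: "'v::euclidean_space \<times> real"
    and I :: "real set"
    and r :: "real \<Rightarrow> real"
    and M :: "'s topology"
    and \<A> :: "('s, 'e::euclidean_space) chart set"
    and \<Phi> \<nu> :: "real \<Rightarrow> 's \<Rightarrow> 'v \<times> real"
  assumes "\<kappa> \<in> {-1, 0, 1}"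
    and "DIM('v) = DIM('e) + 1"
    and "p0 \<in> space_form \<kappa>"
    and "variable_radius_family \<kappa> p0 I r M \<A> \<Phi> \<nu>"
  shows "\<forall>a\<in>I. \<forall>p\<in>manifold_boundary \<A>. \<forall>c\<in>\<A>. p \<in> chart_dom c \<longrightarrow>
    (\<forall>\<eta>. outward_unit_conormal \<kappa> c (\<Phi> a) p \<eta> \<longrightarrow>
       mderiv c (parametric_field \<kappa> I \<Phi> \<nu> a) p \<eta> - ct \<kappa> (r a) * parametric_field \<kappa> I \<Phi> \<nu> a p
       = vector_derivative r (at a within I)
         * second_fundamental_form \<kappa> c (\<Phi> a) (\<nu> a) p \<eta> \<eta>)"
proof (intro ballI allI impI)
  fix a p c \<eta>
  assume a: "a \<in> I" and "p \<in> manifold_boundary \<A>" and c: "c \<in> \<A>" and p: "p \<in> chart_dom c"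
    and \<eta>: "outward_unit_conormal \<kappa> c (\<Phi> a) p \<eta>"
  have I: "is_interval I" "interior I \<noteq> {}" and r_smooth: "smooth_map_on I r"
    and radius: "\<And>s. s \<in> I \<Longrightarrow> 0 < r s" "\<And>s. s \<in> I \<Longrightarrow> \<kappa> = 1 \<Longrightarrow> r s < pi"
    and smooth: "smooth_family_on_manifold I \<A> \<Phi>" "smooth_family_on_manifold I \<A> \<nu>"
    and fbm: "\<And>s. s \<in> I \<Longrightarrow> free_boundary_minimal \<kappa> p0 (r s) M \<A> (\<Phi> s) (\<nu> s)"
    using assms(4) by (auto simp only: variable_radius_family_def)
  have mfd: "manifold_with_boundary M \<A>"
    using fbm[OF a] by (simp only: free_boundary_minimal_def)
  define U where "U = chart_img c"
  define x where "x = chart_map c p"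
  define pt where "pt y = inv_into (chart_dom c) (chart_map c) y" for y
  have dom: "openin M (chart_dom c)" and U: "openin (top_of_set half_space) U"
    and hom: "homeomorphic_map (subtopology M (chart_dom c)) (top_of_set (chart_img c)) (chart_map c)"
    using mfd c unfolding manifold_with_boundary_def U_def by blast+
  have sub: "chart_dom c \<subseteq> topspace M" using dom by (rule openin_subset)
  have inj: "inj_on (chart_map c) (chart_dom c)"
    using homeomorphic_imp_injective_map[OF hom] sub by (simp add: inf.absorb2)
  have pt: "pt y \<in> chart_dom c" "chart_map c (pt y) = y" if "y \<in> U" for y
    unfolding pt_def using that inv_into_into[of y "chart_map c" "chart_dom c"]
      f_inv_into_f[of y "chart_map c" "chart_dom c"] by (simp_all add: U_def chart_img_def)
  have ptx: "pt x = p" using inj p by (simp add: pt_def x_def)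
  have xU: "x \<in> U" using p by (simp add: x_def U_def chart_img_def)
  have in_chart: "in_chart c f y = f (pt y)" for f :: "'s \<Rightarrow> 'z" and y
    by (simp add: in_chart_def pt_def)
  have not_bot: "at a within I \<noteq> bot" by (rule interval_approachable(1)[OF I a])
  have "smooth_map_on (I \<times> U) (\<lambda>(s, y). \<Phi> s (pt y))" "smooth_map_on (I \<times> U) (\<lambda>(s, y). \<nu> s (pt y))"
    using smooth c by (auto simp only: smooth_family_on_manifold_def U_def in_chart)
  then have "\<exists>W1 G. open W1 \<and> (a, x) \<in> W1 \<and> (\<forall>k. Ck_on k W1 G) \<and>
      (\<forall>z\<in>(I \<times> U) \<inter> W1. G z = (\<lambda>(s, y). \<Phi> s (pt y)) z)"
    and "\<exists>W2 N. open W2 \<and> (a, x) \<in> W2 \<and> (\<forall>k. Ck_on k W2 N) \<and>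
      (\<forall>z\<in>(I \<times> U) \<inter> W2. N z = (\<lambda>(s, y). \<nu> s (pt y)) z)"
    unfolding smooth_map_on_def using a xU by blast+
  then obtain W1 G W2 N where
    G: "open W1" "(a, x) \<in> W1" "\<And>k. Ck_on k W1 G" "\<forall>z\<in>(I \<times> U) \<inter> W1. G z = (\<lambda>(s, y). \<Phi> s (pt y)) z"
    and N: "open W2" "(a, x) \<in> W2" "\<And>k. Ck_on k W2 N" "\<forall>z\<in>(I \<times> U) \<inter> W2. N z = (\<lambda>(s, y). \<nu> s (pt y)) z"
    by blast
  define W where "W = W1 \<inter> W2"
  have W: "open W" "(a, x) \<in> W" using G(1,2) N(1,2) by (auto simp: W_def)
  have C2: "Ck_on (Suc (Suc 0)) W G" "Ck_on (Suc (Suc 0)) W N"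
    by (rule Ck_on_subset[OF G(3)] Ck_on_subset[OF N(3)]; simp add: W_def)+
  have G_eq: "G (s, y) = \<Phi> s (pt y)" and N_eq: "N (s, y) = \<nu> s (pt y)" if "s \<in> I" "y \<in> U" "(s, y) \<in> W" for s y
    using G(4) N(4) that by (auto simp: W_def)
  have dG: "(G has_derivative dir_deriv G z) (at z)" and dN: "(N has_derivative dir_deriv N z) (at z)" if "z \<in> W" for z
    using Ck_on_has_derivative[OF C2(1) W(1) that] Ck_on_has_derivative[OF C2(2) W(1) that] by auto
  have mderiv_slice: "mderiv c f (pt y) = (\<lambda>w. D (0, w))"
    if F: "(F has_derivative D) (at (s, y))" and sy: "s \<in> I" "y \<in> U" "(s, y) \<in> W"
      and f: "\<And>y. y \<in> U \<Longrightarrow> (s, y) \<in> W \<Longrightarrow> f (pt y) = F (s, y)"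
    for f :: "'s \<Rightarrow> 'z::real_normed_vector" and F D s y
  proof -
    obtain e where e: "0 < e" "\<forall>y'. dist y' y < e \<longrightarrow> (s, y') \<in> W"
      using open_slices[OF W(1) sy(3)] by (elim exE conjE)
    have y: "chart_map c (pt y) = y" by (rule pt(2)[OF sy(2)])
    show ?thesis
    proof (rule mderiv_eqI[OF pt(1)[OF sy(2)] U[unfolded U_def] _ e(1)])
      show "((\<lambda>y'. F (s, y')) has_derivative (\<lambda>w. D (0, w))) (at (chart_map c (pt y)) within chart_img c)"
        unfolding y by (rule has_derivative_space_slice[OF F])
      show "in_chart c f y' = F (s, y')" if "y' \<in> chart_img c" "dist y' (chart_map c (pt y)) < e" for y'
        unfolding in_chart by (rule f[OF that(1)[folded U_def] e(2)[rule_format, OF that(2)[unfolded y]]])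
    qed
  qed
  have mG: "mderiv c (\<Phi> s) (pt y) = (\<lambda>w. dir_deriv G (s, y) (0, w))" if "s \<in> I" "y \<in> U" "(s, y) \<in> W" for s y
    by (rule mderiv_slice[OF dG[OF that(3)] that]) (simp add: G_eq that(1))
  have mN: "mderiv c (\<nu> a) p = (\<lambda>w. dir_deriv N (a, x) (0, w))"
    using mderiv_slice[OF dN[OF W(2)] a xU W(2), of "\<nu> a"] N_eq[OF a] ptx by simp
  have imm: "immersion_into_space_form \<kappa> \<A> (\<Phi> s)" and unit: "smooth_unit_normal \<kappa> \<A> (\<Phi> s) (\<nu> s)"
    and ball: "\<Phi> s ` topspace M \<subseteq> geodesic_ball \<kappa> p0 (r s)"
    and sphere: "\<Phi> s ` manifold_boundary \<A> \<subseteq> geodesic_sphere \<kappa> p0 (r s)"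
    and orth: "\<And>p. p \<in> manifold_boundary \<A> \<Longrightarrow> ambient_form \<kappa> (\<nu> s p) (radial_field \<kappa> p0 (\<Phi> s p)) = 0"
    if "s \<in> I" for s
    using fbm[OF that] by (simp_all add: free_boundary_minimal_def minimal_immersion_def)
  have bdry: "pt y \<in> manifold_boundary \<A>" if "y \<in> U" "y \<bullet> inward_dir = 0" for y
    using pt[OF that(1)] that(2) c by (auto simp: manifold_boundary_def)
  obtain V g where g: "open V" "a \<in> V" "\<And>k. Ck_on k V g" "\<And>s. s \<in> I \<inter> V \<Longrightarrow> g s = r s"
    using r_smooth a unfolding smooth_map_on_def by metis
  have "(g has_derivative dir_deriv g a) (at a)"
    by (rule Ck_on_has_derivative[OF g(3) g(1,2)])
  then obtain r' where "(g has_real_derivative r') (at a)"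
    using has_real_derivative by blast
  then have "(g has_real_derivative r') (at a within I)" by (rule has_field_derivative_at_within)
  moreover obtain e where "0 < e" "ball a e \<subseteq> V" using g(1,2) open_contains_ball by blast
  ultimately have r': "(r has_real_derivative r') (at a within I)"
    using a g(4) by (auto intro: has_field_derivative_transform_within simp: subset_iff dist_commute)
  have vr: "vector_derivative r (at a within I) = r'"
    using r' not_bot by (intro vector_derivative_within) (simp_all add: has_real_derivative_iff_has_vector_derivative)
  have x0: "x \<bullet> inward_dir = 0" and outward: "\<eta> \<bullet> inward_dir < 0"
    and eta1: "induced_metric \<kappa> c (\<Phi> a) p \<eta> \<eta> = 1"
    and eta2: "\<And>u. u \<bullet> inward_dir = 0 \<Longrightarrow> induced_metric \<kappa> c (\<Phi> a) p \<eta> u = 0"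
    using \<eta> by (simp_all add: outward_unit_conormal_def x_def)
  have mGp: "mderiv c (\<Phi> a) p = (\<lambda>w. dir_deriv G (a, x) (0, w))"
    using mG[OF a xU W(2)] by (simp add: ptx)
  have position: "G z \<in> space_form \<kappa>" if "z \<in> (I \<times> U) \<inter> W" for z
    using that imm pt(1) c G_eq by (cases z) (simp add: immersion_into_space_form_def)
  have normal: "N z \<in> tangent_space \<kappa> (G z)" "ambient_form \<kappa> (N z) (N z) = 1"
    "ambient_form \<kappa> (N z) (dir_deriv G z (0, w)) = 0" if "z \<in> (I \<times> U) \<inter> W" for z w
  proof -
    obtain s y where z: "z = (s, y)" by (cases z)
    then have sy: "s \<in> I" "y \<in> U" "(s, y) \<in> W" using that by auto
    have "\<nu> s (pt y) \<in> tangent_space \<kappa> (\<Phi> s (pt y)) \<and> ambient_form \<kappa> (\<nu> s (pt y)) (\<nu> s (pt y)) = 1 \<and>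
        ambient_form \<kappa> (\<nu> s (pt y)) (mderiv c (\<Phi> s) (pt y) w) = 0"
      using unit[OF sy(1)] c pt(1)[OF sy(2)] by (simp add: smooth_unit_normal_def)
    then show "N z \<in> tangent_space \<kappa> (G z)" "ambient_form \<kappa> (N z) (N z) = 1"
      "ambient_form \<kappa> (N z) (dir_deriv G z (0, w)) = 0"
      by (simp_all add: z G_eq[OF sy] N_eq[OF sy] mG[OF sy])
  qed
  have in_ball: "ambient_form \<kappa> (G (s, y) - p0) (G (s, y) - p0) / 2 \<le> half_chord_sq \<kappa> (r s)"
    if "(s, y) \<in> (I \<times> U) \<inter> W" for s y
  proof -
    have sy: "s \<in> I" "y \<in> U" "(s, y) \<in> W" using that by auto
    have "G (s, y) \<in> geodesic_ball \<kappa> p0 (r s)"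
      using ball[OF sy(1)] pt(1)[OF sy(2)] sub by (auto simp: G_eq[OF sy])
    then show ?thesis by (rule half_chord_sq_le[OF assms(1,3) _ radius(2)[OF sy(1)]])
  qed
  have boundary: "ambient_form \<kappa> (G (s, y) - p0) (G (s, y) - p0) / 2 = half_chord_sq \<kappa> (r s)"
    "ambient_form \<kappa> (N (s, y)) (cs \<kappa> (r s) *\<^sub>R G (s, y) - p0) = 0"
    if "(s, y) \<in> (I \<times> U) \<inter> W" "y \<bullet> inward_dir = 0" for s y
  proof -
    have sy: "s \<in> I" "y \<in> U" "(s, y) \<in> W" using that by auto
    have S: "G (s, y) \<in> geodesic_sphere \<kappa> p0 (r s)"
      using sphere[OF sy(1)] bdry[OF sy(2) that(2)] by (auto simp: G_eq[OF sy])
    then show "ambient_form \<kappa> (G (s, y) - p0) (G (s, y) - p0) / 2 = half_chord_sq \<kappa> (r s)"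
      using half_chord_sq_space_dist[OF assms(1,3), of "G (s, y)"] by (simp add: geodesic_sphere_def)
    have perp: "ambient_form \<kappa> (N (s, y)) (radial_field \<kappa> p0 (G (s, y))) = 0"
      using orth[OF sy(1) bdry[OF sy(2) that(2)]] by (simp add: G_eq[OF sy] N_eq[OF sy])
    show "ambient_form \<kappa> (N (s, y)) (cs \<kappa> (r s) *\<^sub>R G (s, y) - p0) = 0"
      by (rule sphere_normal_orthogonal[OF assms(1,3) S radius(1)[OF sy(1)] _ perp])
        (rule radius(2)[OF sy(1)])
  qed
  have immersed: "inj (\<lambda>w. dir_deriv G (a, x) (0, w))"
    using imm[OF a] c p unfolding immersion_into_space_form_def mGp[symmetric] by blast
  have eta: "ambient_form \<kappa> (dir_deriv G (a, x) (0, \<eta>)) (dir_deriv G (a, x) (0, \<eta>)) = 1"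
    "\<And>u. u \<bullet> inward_dir = 0 \<Longrightarrow> ambient_form \<kappa> (dir_deriv G (a, x) (0, \<eta>)) (dir_deriv G (a, x) (0, u)) = 0"
    using eta1 eta2 by (simp_all add: induced_metric_def mGp)
  interpret chart: free_boundary_chart \<kappa> p0 I U W r G N a r' x \<eta>
    by (rule free_boundary_chart.intro[OF assms(1-3) I U W(1) C2 radius position normal in_ball
          boundary a xU W(2) x0 immersed r' outward eta])
  have field: "parametric_field \<kappa> I \<Phi> \<nu> a (pt y) = ambient_form \<kappa> (dir_deriv G (a, y) (1, 0)) (N (a, y))"
    if y: "y \<in> U" "(a, y) \<in> W" for y
  proof -
    obtain e where e: "0 < e" "\<forall>s. dist s a < e \<longrightarrow> (s, y) \<in> W"
      using open_slices[OF W(1) y(2)] by (elim exE conjE)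
    have "((\<lambda>s. \<Phi> s (pt y)) has_vector_derivative dir_deriv G (a, y) (1, 0)) (at a within I)"
      by (rule has_vector_derivative_transform_within[OF has_derivative_time_slice[OF dG[OF y(2)]] e(1) a])
        (use G_eq y(1) e(2) in blast)
    from vector_derivative_within[OF not_bot this]
    show ?thesis by (simp add: parametric_field_def N_eq[OF a y])
  qed
  have "((\<lambda>z. ambient_form \<kappa> (dir_deriv G z (1, 0)) (N z)) has_derivative
      (\<lambda>v. ambient_form \<kappa> (dir_deriv G (a, x) (1, 0)) (dir_deriv N (a, x) v)
        + ambient_form \<kappa> (dir_deriv (\<lambda>z. dir_deriv G z (1, 0)) (a, x) v) (N (a, x)))) (at (a, x))"
    by (rule ambient.FDERIV[OF chart.DG_deriv chart.N_deriv])
  from mderiv_slice[OF this a xU W(2) field]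
  have m_field: "mderiv c (parametric_field \<kappa> I \<Phi> \<nu> a) p \<eta>
      = ambient_form \<kappa> (dir_deriv G (a, x) (1, 0)) (dir_deriv N (a, x) (0, \<eta>))
        + ambient_form \<kappa> (dir_deriv (\<lambda>z. dir_deriv G z (1, 0)) (a, x) (0, \<eta>)) (N (a, x))"
    by (simp add: ptx)
  have "\<kappa> * ambient_form \<kappa> (G (a, x)) (dir_deriv G (a, x) (0, \<eta>)) = 0"
    by (rule position_orthogonal[OF assms(1) chart.tangent_G])
  \<comment> \<open>The projection onto the tangent space removes a multiple of the position vector, which is
    orthogonal to the hypersurface.\<close>
  then have A: "second_fundamental_form \<kappa> c (\<Phi> a) (\<nu> a) p \<eta> \<eta>
      = ambient_form \<kappa> (dir_deriv N (a, x) (0, \<eta>)) (dir_deriv G (a, x) (0, \<eta>))"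
    using G_eq[OF a xU W(2)]
    by (auto simp: second_fundamental_form_def covariant_deriv_def tangential_part_def mN mGp ptx
        ambient.diff_left ambient.scaleR_left)
  show "mderiv c (parametric_field \<kappa> I \<Phi> \<nu> a) p \<eta> - ct \<kappa> (r a) * parametric_field \<kappa> I \<Phi> \<nu> a p
       = vector_derivative r (at a within I) * second_fundamental_form \<kappa> c (\<Phi> a) (\<nu> a) p \<eta> \<eta>"
    using chart.boundary_identity field[OF xU W(2)]
    by (simp add: m_field A vr ptx chart.V_def chart.P_def)
qed

end
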